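(* Let $A$ and $B$ be matrices in $\mathbb{C}^{d\times d}$. Then the matrix function $\mathcal{H}_8(A,B;x,y)$ satisfies the following infinite summation formulae for $|t|<1$: (1) $(1-t)^{-A}\,\mathcal{H}_8\!\left(A,B;\frac{x}{(1-t)^2},y(1-t)\right)=\sum_{n=0}^{\infty}\frac{(A)_n}{n!}\,\mathcal{H}_8(A+nI,B;x,y)\,t^n$; (2) $\mathcal{H}_8\!\left(A,B;x(1-t),\frac{y}{1-t}\right)(1-t)^{-B}=\sum_{n=0}^{\infty}\mathcal{H}_8(A,B+nI;x,y)\,\frac{(B)_n}{n!}\,t^n$.
   Context: $\mathcal{H}_8(A,B;x,y)=\sum_{m,n\ge0}(A)_{2m-n}(B)_{n-m}\frac{x^m y^n}{m!\,n!}$. Matrix Pochhammer symbol: for $M\in\mathbb{C}^{d\times d}$, $(M)_0=I$, $(M)_n=M(M+I)\cdots(M+(n-1)I)$ for $n\ge1$, and $(M)_{-n}=(-1)^n(I-M)_n^{-1}$. For $|t|<1$, $(1-t)^{-M}=\sum_{n\ge0}\frac{(M)_n}{n!}t^n$.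
   Formalization: The series can diverge for some |t|<1, so each formula is stated where 4|x|<(1-|t|)^2, resp. 4|x|(1+|t|)<1, or where the series converges; all Pochhammer symbols are assumed to exist, and both first arguments of H_8 have modulus below 1/4. *)

theory Defs
  imports "HOL-Analysis.Analysis"
begin

text \<open>The library's \<^const>\<open>scaleR\<close> only scales complex matrices by real numbers.\<close>

definition cscale :: "complex \<Rightarrow> complex^'d^'d \<Rightarrow> complex^'d^'d" (infixr "*\<^sub>M" 75)
  where "c *\<^sub>M M = (\<chi> i j. c * M $ i $ j)"

primrec mpoch :: "complex^'d^'d \<Rightarrow> nat \<Rightarrow> complex^'d^'d"
  where
    "mpoch M 0 = mat 1"
  | "mpoch M (Suc n) = mpoch M n ** (M + mat (of_nat n))"

definition mpoch_int :: "complex^'d^'d \<Rightarrow> int \<Rightarrow> complex^'d^'d"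
  where "mpoch_int M k =
    (if 0 \<le> k then mpoch M (nat k)
     else (-1) ^ nat (- k) *\<^sub>M matrix_inv (mpoch (mat 1 - M) (nat (- k))))"

text \<open>The symbols \<open>(M)\<^sub>-\<^sub>k\<close>, \<open>k \<ge> 0\<close>, exist exactly when the matrices \<open>(I - M)\<^sub>k\<close> are invertible;
  otherwise \<^const>\<open>matrix_inv\<close> returns an unspecified matrix.\<close>

definition mpoch_int_defined :: "complex^'d^'d \<Rightarrow> bool"
  where "mpoch_int_defined M \<longleftrightarrow> (\<forall>k. invertible (mpoch (mat 1 - M) k))"

text \<open>\<open>one_minus_powr_neg t M\<close> is \<open>(1 - t)\<^sup>-\<^sup>M\<close>, for \<open>\<bar>t\<bar> < 1\<close>.\<close>

definition one_minus_powr_neg :: "complex \<Rightarrow> complex^'d^'d \<Rightarrow> complex^'d^'d"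
  where "one_minus_powr_neg t M = (\<Sum>n. (t ^ n / fact n) *\<^sub>M mpoch M n)"

text \<open>When \<open>A\<close> and \<open>B\<close> satisfy \<^const>\<open>mpoch_int_defined\<close>, the double series converges absolutely
  for \<open>\<bar>x\<bar> < 1/4\<close> and all \<open>y\<close>. The matrices \<open>A\<close> and \<open>B\<close> need not commute, so the order
  of the factors matters.\<close>

definition hornH8 ::
  "complex^'d^'d \<Rightarrow> complex^'d^'d \<Rightarrow> complex \<Rightarrow> complex \<Rightarrow> complex^'d^'d"
  where "hornH8 A B x y =
    (\<Sum>\<^sub>\<infinity>(m, n)\<in>UNIV. (x ^ m * y ^ n / (fact m * fact n)) *\<^sub>M
       (mpoch_int A (2 * int m - int n) ** mpoch_int B (int n - int m)))"

end

theory Submission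
  imports Defs "HOL-Complex_Analysis.Conformal_Mappings"
begin

text \<open>
  Insert the double series of the shifted Horn function into the right-hand side of the first formula.
  Since \<open>(A)\<^sub>n (A + n I)\<^sub>k = (A)\<^sub>n\<^sub>+\<^sub>k\<close> for every integer \<open>k\<close> (\<open>mpoch_mpoch_int_shift\<close>), the result is a triple
  series over \<open>n\<close>, \<open>m\<close>, \<open>p\<close> in which \<open>n\<close> occurs only in \<open>(A)\<^sub>n\<^sub>+\<^sub>k t\<^sup>n / n!\<close> with \<open>k = 2m - p\<close>. Its sum over \<open>n\<close> is
  a binomial series with shifted index, equal to \<open>(1 - t)\<close> to the power \<open>-A\<close>, times \<open>(A)\<^sub>k\<close>, times the
  scalar \<open>1 - t\<close> to the power \<open>-k = p - 2m\<close> (\<open>shifted_binomial_series\<close>), and that scalar rescales \<open>x\<close> and \<open>y\<close>. The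
  second formula arises in the same way from \<open>k = p - m\<close>.

  The order of summation may be changed as long as the triple series converges absolutely. The norm of
  \<open>(M)\<^sub>k\<close> is at most \<open>C r\<^sup>\<bar>\<^sup>k\<^sup>\<bar>\<close> times \<open>k!\<close> or \<open>1 / (-k)!\<close>, for every \<open>r > 1\<close> (\<open>norm_mpoch_int_le\<close>); this reduces
  the question to scalar series, whose terms are estimated by binomial coefficients
  (\<open>int_fact_mult_le\<close>, \<open>int_fact_series\<close>). Absolute convergence results for \<open>4 \<bar>x\<bar> < (1 - \<bar>t\<bar>)\<^sup>2\<close> and for
  \<open>4 \<bar>x\<bar> (1 + \<bar>t\<bar>) < 1\<close>, respectively (\<open>hornH8_sums_first\<close>, \<open>hornH8_sums_second\<close>).

  For other \<open>t\<close> the series, a power series in \<open>t\<close>, is only known to converge at \<open>t\<close>, hence on the open disc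
  of radius \<open>\<bar>t\<bar>\<close>. The closed form is holomorphic in \<open>s\<close> as long as \<open>\<bar>s\<bar> < 1\<close> and the first argument of the
  Horn function has modulus below \<open>1/4\<close>. The two agree near \<open>0\<close>, therefore on the intersection of their
  domains, which is connected (\<open>connected_disc_minus_disc\<close> for the first formula, convexity for the
  second). Finally \<open>t\<close>, on the boundary of the disc, is reached by Abel's limit theorem
  (\<open>power_series_sums_by_continuation\<close>).
\<close>

section \<open>Complex scaling and matrix multiplication\<close>

lemma cscale_nth [simp]: "(c *\<^sub>M M) $ i $ j = c * M $ i $ j"
  by (simp add: cscale_def)

lemma cscale_cscale [simp]: "c *\<^sub>M (d *\<^sub>M M) = (c * d) *\<^sub>M M"
  by (simp add: vec_eq_iff mult.assoc)

lemma cscale_one [simp]: "1 *\<^sub>M M = M"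
  by (simp add: vec_eq_iff)

lemma cscale_mult_left: "(c *\<^sub>M M) ** N = c *\<^sub>M (M ** N)"
  by (simp add: vec_eq_iff matrix_matrix_mult_def sum_distrib_left mult.assoc)

lemma cscale_mult_right: "M ** (c *\<^sub>M N) = c *\<^sub>M (M ** N)"
  by (simp add: vec_eq_iff matrix_matrix_mult_def sum_distrib_left mult.left_commute)

lemma matrix_add_rdistrib: "((A :: complex^'d^'d) + B) ** C = A ** C + B ** C"
  by (simp add: vec_eq_iff matrix_matrix_mult_def distrib_right sum.distrib)

lemma cscale_add_right: "c *\<^sub>M (M + N) = c *\<^sub>M M + c *\<^sub>M N"
  by (simp add: vec_eq_iff distrib_left)

lemma cscale_add_left: "(c + d) *\<^sub>M M = c *\<^sub>M M + d *\<^sub>M M"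
  by (simp add: vec_eq_iff distrib_right)

lemma mult_mat_right: "M ** mat c = c *\<^sub>M (M :: complex^'d^'d)"
  by (simp add: vec_eq_iff matrix_matrix_mult_def mat_def if_distrib mult.commute cong: if_cong)

lemma mult_mat_left: "mat c ** M = c *\<^sub>M (M :: complex^'d^'d)"
  by (simp add: vec_eq_iff matrix_matrix_mult_def mat_def if_distrib if_distribR cong: if_cong)

lemma norm_cscale: "norm (c *\<^sub>M M) = norm c * norm M"
  by (simp add: norm_vec_def norm_mult L2_set_right_distrib)

lemma bounded_linear_cscale: "bounded_linear (cscale c)"
  by (rule bounded_linear_intro[where K = "norm c"])
    (auto simp: vec_eq_iff distrib_left norm_cscale mult.commute)

text \<open>Boundedness of the product is all that the convergence arguments use: sums may be multiplied by a
  matrix from either side, and norms of products are controlled up to a constant factor.\<close>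

lemma bounded_bilinear_matrix_mult:
  "bounded_bilinear ((**) :: complex^'d^'d \<Rightarrow> complex^'d^'d \<Rightarrow> complex^'d^'d)"
proof -
  have "bilinear ((**) :: complex^'d^'d \<Rightarrow> complex^'d^'d \<Rightarrow> complex^'d^'d)"
    unfolding bilinear_def
    by (auto intro!: linearI simp: matrix_add_ldistrib matrix_add_rdistrib)
       (simp_all add: vec_eq_iff matrix_matrix_mult_def scaleR_sum_right)
  then show ?thesis
    by (simp add: bilinear_conv_bounded_bilinear)
qed

lemma matrix_inv_right: "invertible P \<Longrightarrow> P ** matrix_inv P = mat 1"
  and matrix_inv_left: "invertible P \<Longrightarrow> matrix_inv P ** P = mat 1"
  unfolding matrix_inv_def invertible_def by (metis (mono_tags, lifting) someI_ex)+

lemma matrix_inv_unique: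
  fixes P :: "complex^'d^'d"
  assumes "X ** P = mat 1"
  shows "matrix_inv P = X"
proof -
  have "invertible P"
    using assms invertible_left_inverse by blast
  then have "X ** (P ** matrix_inv P) = X"
    by (simp add: matrix_inv_right)
  then show ?thesis
    by (simp add: matrix_mul_assoc assms)
qed

lemma matrix_inv_commute:
  fixes P :: "complex^'d^'d"
  assumes "invertible P" "X ** P = P ** X"
  shows "X ** matrix_inv P = matrix_inv P ** X"
proof -
  have "matrix_inv P ** (X ** P) ** matrix_inv P = matrix_inv P ** (P ** X) ** matrix_inv P"
    using assms by simp
  then show ?thesis
    by (metis assms(1) matrix_inv_left matrix_inv_right matrix_mul_assoc matrix_mul_lid matrix_mul_rid)
qed

section \<open>Matrix Pochhammer symbols of integer index\<close>

text \<open>The matrices \<open>A\<close> and \<open>B\<close> need not commute, but everything built from a single matrix \<open>M\<close> commutes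
  with whatever commutes with \<open>M\<close>. This is propagated from \<open>M\<close> through shifts, products and inverses.\<close>

lemma commute_add_mat:
  fixes M :: "complex^'d^'d"
  assumes "X ** M = M ** X"
  shows "X ** (M + mat c) = (M + mat c) ** X"
  using assms by (simp add: matrix_add_ldistrib matrix_add_rdistrib mult_mat_left mult_mat_right)

lemma mpoch_commute:
  assumes "X ** M = M ** X"
  shows "X ** mpoch M n = mpoch M n ** X"
proof (induction n)
  case (Suc n)
  then show ?case
    using commute_add_mat[OF assms, of "of_nat n"]
    by (metis matrix_mul_assoc mpoch.simps(2))
qed simp

lemma commute_one_minus:
  fixes M :: "complex^'d^'d"
  assumes "X ** M = M ** X"
  shows "X ** (mat 1 - M) = (mat 1 - M) ** X"
proof -
  have "mat 1 - M = (-1) *\<^sub>M (M + mat (-1))"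
    by (simp add: vec_eq_iff mat_def)
  then show ?thesis
    by (simp add: cscale_mult_left cscale_mult_right commute_add_mat[OF assms])
qed

lemma mpoch_int_commute:
  assumes "mpoch_int_defined M" "X ** M = M ** X"
  shows "X ** mpoch_int M k = mpoch_int M k ** X"
  using assms
  by (simp add: mpoch_int_def mpoch_commute commute_one_minus matrix_inv_commute
      mpoch_int_defined_def cscale_mult_left cscale_mult_right)

lemma mpoch_int_of_nat [simp]: "mpoch_int M (int n) = mpoch M n"
  by (simp add: mpoch_int_def)

lemma mpoch_int_zero [simp]: "mpoch_int M 0 = mat 1"
  by (simp add: mpoch_int_def)

lemma mpoch_int_minus_of_nat:
  "mpoch_int M (- int n) = (-1) ^ n *\<^sub>M matrix_inv (mpoch (mat 1 - M) n)"
  by (cases "n = 0") (simp_all add: mpoch_int_def matrix_inv_unique)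

text \<open>The factors of \<open>(I - M)\<^sub>n\<close>, which are inverted in \<open>(M)\<^sub>-\<^sub>n\<close>, are up to sign the factors
  \<open>M + k I\<close> with negative \<open>k\<close> that the recurrence below asks for.\<close>

lemma reflected_factor:
  "mat 1 - M + mat (of_nat n) = (-1) *\<^sub>M (M + mat (of_int (- int (Suc n))))"
  by (simp add: vec_eq_iff mat_def)

text \<open>One recurrence governs the symbol on both sides of index zero; together with the invertibility of
  \<open>M + k I\<close> for \<open>k < 0\<close> it determines the symbol, so that identities for all integer indices reduce
  to checking the recurrence and the value at zero.\<close>

lemma mpoch_int_add_one:
  assumes "mpoch_int_defined M"
  shows "mpoch_int M (k + 1) = mpoch_int M k ** (M + mat (of_int k))"
proof (cases "k \<ge> 0")
  case True
  then obtain n where "k = int n" by (metis nonneg_int_cases)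
  then have "mpoch_int M (k + 1) = mpoch M (Suc n)"
    by (metis mpoch_int_of_nat of_nat_Suc add.commute)
  then show ?thesis
    using \<open>k = int n\<close> by simp
next
  case False
  define n where "n = nat (- k - 1)"
  have k: "k = - int (Suc n)" "k + 1 = - int n"
    using False by (auto simp: n_def)
  define P where "P = mpoch (mat 1 - M)"
  have inv: "invertible (P (Suc n))"
    using assms unfolding mpoch_int_defined_def P_def by blast
  define Q where "Q = mat 1 - M + mat (of_nat n)"
  have "P n ** Q = Q ** P n"
    unfolding P_def Q_def by (metis commute_add_mat mpoch_commute)
  then have "matrix_inv (P (Suc n)) ** Q ** P n = matrix_inv (P (Suc n)) ** P (Suc n)"
    by (simp add: P_def Q_def flip: matrix_mul_assoc)
  also have "\<dots> = mat 1"
    by (simp add: inv matrix_inv_left)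
  finally have "matrix_inv (P n) = matrix_inv (P (Suc n)) ** Q"
    by (rule matrix_inv_unique)
  then have fin: "matrix_inv (P n) = (-1) *\<^sub>M (matrix_inv (P (Suc n)) ** (M + mat (of_int k)))"
    unfolding Q_def reflected_factor k(1) cscale_mult_right .
  have "mpoch_int M (k + 1) = (-1) ^ n *\<^sub>M matrix_inv (P n)"
    unfolding k(2) P_def by (rule mpoch_int_minus_of_nat)
  also have "\<dots> = ((-1) ^ Suc n *\<^sub>M matrix_inv (P (Suc n))) ** (M + mat (of_int k))"
    unfolding fin cscale_cscale cscale_mult_left by simp
  also have "(-1) ^ Suc n *\<^sub>M matrix_inv (P (Suc n)) = mpoch_int M k"
    unfolding k(1) P_def by (rule mpoch_int_minus_of_nat[symmetric])
  finally show ?thesis .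
qed

text \<open>\<open>M + k I\<close> is, up to sign, the last factor of an invertible \<open>(I - M)\<^sub>n\<close>, and a factor of an
  invertible matrix is invertible.\<close>

lemma invertible_negative_factor:
  fixes M :: "complex^'d^'d"
  assumes "mpoch_int_defined M" "k < 0"
  shows "invertible (M + mat (of_int k))"
proof -
  define n where "n = nat (- k - 1)"
  have k: "k = - int (Suc n)"
    using assms by (auto simp: n_def)
  let ?P = "mpoch (mat 1 - M)"
  have inv: "invertible (?P (Suc n))"
    using assms unfolding mpoch_int_defined_def by blast
  have "matrix_inv (?P (Suc n)) ** ?P n ** (mat 1 - M + mat (of_nat n)) = mat 1"
    using matrix_inv_left[OF inv] by (simp add: matrix_mul_assoc)
  then have "((-1) *\<^sub>M (matrix_inv (?P (Suc n)) ** ?P n)) ** (M + mat (of_int k)) = mat 1"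
    unfolding reflected_factor k by (simp add: cscale_mult_left cscale_mult_right)
  then show ?thesis
    using invertible_left_inverse by blast
qed

text \<open>Upwards the recurrence is applied, downwards it is solved, which requires its factors to be
  invertible at negative indices only.\<close>

lemma int_recurrence_unique:
  fixes a b N :: "int \<Rightarrow> complex^'d^'d"
  assumes a: "\<And>k. a (k + 1) = a k ** N k" and b: "\<And>k. b (k + 1) = b k ** N k"
    and inv: "\<And>k. k < 0 \<Longrightarrow> invertible (N k)" and "a 0 = b 0"
  shows "a k = b k"
proof (induction k rule: int_induct[where k = 0])
  case base
  show ?case by fact
next
  case (step1 i)
  then show ?case by (simp add: a b)
next
  case (step2 i)
  then have "a (i - 1) ** N (i - 1) = b (i - 1) ** N (i - 1)"
    using a[of "i - 1"] b[of "i - 1"] by simp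
  then have "a (i - 1) ** (N (i - 1) ** matrix_inv (N (i - 1)))
      = b (i - 1) ** (N (i - 1) ** matrix_inv (N (i - 1)))"
    by (simp add: matrix_mul_assoc)
  then show ?case
    using inv[of "i - 1"] step2(1) by (simp add: matrix_inv_right)
qed

text \<open>Both sides satisfy the recurrence with factors \<open>A + (n + k) I\<close> and agree at \<open>k = 0\<close>. This merges the
  coefficient \<open>(A)\<^sub>n\<close> with the symbol \<open>(A + n I)\<^sub>k\<close> inside the shifted Horn function.\<close>

lemma mpoch_mpoch_int_shift:
  assumes "mpoch_int_defined A" "mpoch_int_defined (A + mat (of_nat n))"
  shows "mpoch A n ** mpoch_int (A + mat (of_nat n)) k = mpoch_int A (int n + k)"
proof (rule int_recurrence_unique[where N = "\<lambda>k. A + mat (of_nat n) + mat (of_int k)"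
        and a = "\<lambda>k. mpoch A n ** mpoch_int (A + mat (of_nat n)) k"
        and b = "\<lambda>k. mpoch_int A (int n + k)"])
  fix k
  show "mpoch A n ** mpoch_int (A + mat (of_nat n)) (k + 1)
      = mpoch A n ** mpoch_int (A + mat (of_nat n)) k ** (A + mat (of_nat n) + mat (of_int k))"
    by (simp add: mpoch_int_add_one[OF assms(2)] matrix_mul_assoc)
  have "A + mat (of_int (int n + k)) = A + mat (of_nat n) + mat (of_int k)"
    by (simp add: vec_eq_iff mat_def)
  then show "mpoch_int A (int n + (k + 1))
      = mpoch_int A (int n + k) ** (A + mat (of_nat n) + mat (of_int k))"
    using mpoch_int_add_one[OF assms(1), of "int n + k"] by (simp add: add.assoc)
qed (use assms in \<open>auto intro: invertible_negative_factor\<close>)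

section \<open>Growth of the Pochhammer symbols\<close>

text \<open>The scalar model for the size of a Pochhammer symbol of index \<open>k\<close>: going from \<open>k\<close> to \<open>k + 1\<close>
  multiplies by about \<open>\<bar>k\<bar>\<close>, which gives \<open>k!\<close> upwards from zero and \<open>1 / (-k)!\<close> downwards.\<close>

definition int_fact :: "int \<Rightarrow> real"
  where "int_fact k = (if 0 \<le> k then fact (nat k) else 1 / fact (nat (- k)))"

lemma int_fact_of_nat [simp]: "int_fact (int n) = fact n"
  by (simp add: int_fact_def)

lemma int_fact_minus_of_nat: "int_fact (- int n) = 1 / fact n"
  by (simp add: int_fact_def)

lemma int_fact_pos [simp]: "0 < int_fact k"
  by (simp add: int_fact_def)

lemma eventually_decreasing_imp_bounded:
  fixes v :: "nat \<Rightarrow> real"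
  assumes "eventually (\<lambda>n. v (Suc n) \<le> v n) sequentially"
  obtains C where "\<And>n. v n \<le> C"
proof -
  obtain N where N: "\<And>n. n \<ge> N \<Longrightarrow> v (Suc n) \<le> v n"
    using assms by (auto simp: eventually_sequentially)
  have "v n \<le> Max (v ` {..N})" for n
  proof (induction n)
    case (Suc n)
    show ?case
    proof (cases "Suc n \<le> N")
      case False
      then show ?thesis using N[of n] Suc by simp
    qed simp
  qed simp
  then show thesis using that by blast
qed

text \<open>Multiplication by \<open>M + c I\<close> changes the norm by a factor between \<open>\<bar>c\<bar> - L\<close> and \<open>\<bar>c\<bar> + L\<close>. The lower
  bound controls inverses without any spectral theory.\<close>

lemma norm_add_scalar_mult_le:
  fixes M :: "complex^'d^'d"
  shows "\<exists>L. 0 \<le> L \<and> (\<forall>(X :: complex^'d^'d) c.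
    norm (X ** (M + mat c)) \<le> (norm c + L) * norm X \<and>
    norm c * norm X \<le> norm (X ** (M + mat c)) + L * norm X)"
proof -
  obtain K where K: "\<And>(X :: complex^'d^'d) (Y :: complex^'d^'d). norm (X ** Y) \<le> norm X * norm Y * K" "K \<ge> 0"
    using bounded_bilinear.nonneg_bounded[OF bounded_bilinear_matrix_mult[where 'd = 'd]] by blast
  show ?thesis
  proof (intro exI conjI allI)
    show "0 \<le> norm M * K" using K by simp
    fix X :: "complex^'d^'d" and c
    have eq: "X ** (M + mat c) = X ** M + c *\<^sub>M X"
      by (simp add: matrix_add_ldistrib mult_mat_right)
    have XM: "norm (X ** M) \<le> norm M * K * norm X"
      using K(1)[of X M] by (simp add: mult_ac)
    show "norm (X ** (M + mat c)) \<le> (norm c + norm M * K) * norm X"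
      unfolding eq using norm_triangle_ineq[of "X ** M" "c *\<^sub>M X"] XM
      by (simp add: norm_cscale algebra_simps)
    show "norm c * norm X \<le> norm (X ** (M + mat c)) + norm M * K * norm X"
      unfolding eq using norm_diff_ineq[of "c *\<^sub>M X" "X ** M"] XM
      by (simp add: norm_cscale algebra_simps)
  qed
qed

text \<open>By the recurrence, one step in the index multiplies the norm by at most \<open>\<bar>k\<bar> + L\<close> (upwards) or
  \<open>1 / (\<bar>k\<bar> - L)\<close> (downwards). For large \<open>\<bar>k\<bar>\<close> these are at most \<open>r\<close> times the corresponding step of
  \<^const>\<open>int_fact\<close>, hence the normalised norms eventually decrease. The arbitrary \<open>r > 1\<close> absorbs the
  polynomial growth that depends on the spectrum of \<open>M\<close>; all convergence regions are open, so it
  costs nothing.\<close>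

lemma norm_mpoch_int_le:
  fixes M :: "complex^'d^'d"
  assumes def: "mpoch_int_defined M" and r: "1 < r"
  shows "\<exists>C\<ge>0. \<forall>k. norm (mpoch_int M k) \<le> C * r ^ nat \<bar>k\<bar> * int_fact k"
proof -
  obtain L where L': "0 \<le> L \<and> (\<forall>(X :: complex^'d^'d) c.
      norm (X ** (M + mat c)) \<le> (norm c + L) * norm X \<and>
      norm c * norm X \<le> norm (X ** (M + mat c)) + L * norm X)"
    using norm_add_scalar_mult_le[of M] ..
  have L: "norm (X ** (M + mat c)) \<le> (norm c + L) * norm X"
    "norm c * norm X \<le> norm (X ** (M + mat c)) + L * norm X" for X :: "complex^'d^'d" and c
    using L' by blast+
  define up where "up n = norm (mpoch_int M (int n)) / (r ^ n * fact n)" for n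
  define dn where "dn n = norm (mpoch_int M (- int n)) * fact n / r ^ n" for n
  \<comment> \<open>Equivalent to \<open>n + L \<le> r n\<close>, which bounds an upward step.\<close>
  have "eventually (\<lambda>n. L \<le> (r - 1) * real n) sequentially"
  proof -
    have "filterlim (\<lambda>n. (r - 1) * real n) at_top sequentially"
      using r by (intro filterlim_tendsto_pos_mult_at_top[OF tendsto_const] filterlim_real_sequentially) auto
    then show ?thesis
      by (simp add: filterlim_at_top)
  qed
  then have up: "eventually (\<lambda>n. up (Suc n) \<le> up n) sequentially"
  proof eventually_elim
    case (elim n)
    have "norm (mpoch_int M (int (Suc n))) \<le> (real n + L) * norm (mpoch_int M (int n))"
      using L(1)[of "mpoch_int M (int n)" "of_int (int n)"] mpoch_int_add_one[OF def, of "int n"]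
      by (simp add: add.commute)
    also have "\<dots> \<le> (r * (real n + 1)) * norm (mpoch_int M (int n))"
      using elim r by (intro mult_right_mono) (auto simp: algebra_simps)
    finally have "up (Suc n) \<le> (r * (real n + 1)) * norm (mpoch_int M (int n)) / (r ^ Suc n * fact (Suc n))"
      using r unfolding up_def by (intro divide_right_mono) auto
    also have "r ^ Suc n * fact (Suc n) = (r * (real n + 1)) * (r ^ n * fact n)"
      by (simp add: algebra_simps)
    also have "(r * (real n + 1)) * norm (mpoch_int M (int n)) / \<dots> = up n"
      unfolding up_def using r by (intro mult_divide_mult_cancel_left) auto
    finally show ?case .
  qed
  \<comment> \<open>Equivalent to \<open>n / r \<le> n - L\<close>, which bounds a downward step.\<close>
  have "eventually (\<lambda>n. L \<le> (1 - 1 / r) * real n) sequentially"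
  proof -
    have "filterlim (\<lambda>n. (1 - 1 / r) * real n) at_top sequentially"
      using r by (intro filterlim_tendsto_pos_mult_at_top[OF tendsto_const] filterlim_real_sequentially) auto
    then show ?thesis
      by (simp add: filterlim_at_top)
  qed
  then have dn: "eventually (\<lambda>n. dn (Suc n) \<le> dn n) sequentially"
  proof eventually_elim
    case (elim n)
    define X where "X = mpoch_int M (- int (Suc n))"
    have idx: "- int (Suc n) + 1 = - int n"
      by simp
    have *: "norm (of_int (- int (Suc n)) :: complex) = real n + 1"
      unfolding norm_of_int by (simp only: abs_minus_cancel abs_of_nat of_int_of_nat_eq of_nat_Suc add.commute)
    have X: "mpoch_int M (- int n) = X ** (M + mat (of_int (- int (Suc n))))"
      using mpoch_int_add_one[OF def, of "- int (Suc n)"] unfolding idx X_def .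
    have "(real n + 1) * norm X \<le> norm (mpoch_int M (- int n)) + L * norm X"
      using L(2)[of "of_int (- int (Suc n))" X] unfolding * X .
    moreover have "(real n + 1) / r * norm X \<le> (real n + 1 - L) * norm X"
      using elim r by (intro mult_right_mono) (auto simp: field_simps)
    moreover have "(real n + 1 - L) * norm X = (real n + 1) * norm X - L * norm X"
      by (rule left_diff_distrib)
    ultimately have "(real n + 1) / r * norm X \<le> norm (mpoch_int M (- int n))"
      by linarith
    then have "(real n + 1) / r * norm X * (fact n / r ^ n) \<le> norm (mpoch_int M (- int n)) * (fact n / r ^ n)"
      using r by (intro mult_right_mono) auto
    moreover have "(real n + 1) / r * norm X * (fact n / r ^ n) = dn (Suc n)"
      unfolding dn_def X_def[symmetric] by (simp add: algebra_simps add_divide_distrib)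
    ultimately show ?case
      unfolding dn_def[of n] by simp
  qed
  obtain C where C: "\<And>n. up n \<le> C"
    using up by (rule eventually_decreasing_imp_bounded) blast
  obtain D where D: "\<And>n. dn n \<le> D"
    using dn by (rule eventually_decreasing_imp_bounded) blast
  note CD = C D
  define E where "E = max C D"
  have E: "up n \<le> E" "dn n \<le> E" for n
    using C[of n] D[of n] by (simp_all add: E_def)
  have "norm (mpoch_int M k) \<le> E * r ^ nat \<bar>k\<bar> * int_fact k" for k
  proof (cases "k \<ge> 0")
    case True
    then have n: "k = int (nat k)"
      by simp
    show ?thesis
      using E(1)[of "nat k"] r True unfolding up_def by (simp add: int_fact_def field_simps)
  next
    case False
    then have "- int (nat (- k)) = k"
      by simp
    then show ?thesis
      using E(2)[of "nat (- k)"] r False unfolding dn_def by (simp add: int_fact_def field_simps)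
  qed
  moreover have "E \<ge> 0"
    using E(1)[of 0] by (simp add: up_def order_trans[OF norm_ge_zero])
  ultimately show ?thesis by blast
qed

text \<open>The combinatorial source of the radius \<open>1/4\<close>: depending on the signs of the two indices, the
  left-hand side is a binomial coefficient over \<open>p!\<close>, or the inverse of one, and the binomial
  coefficients are bounded by powers of two.\<close>

lemma int_fact_mult_le:
  "int_fact (2 * int m - int p) * int_fact (int p - int m) / (fact m * fact p) \<le> 4 ^ m * 2 ^ p / fact p"
proof -
  have choose_le: "fact (a + b) / (fact a * fact b) \<le> (2 ^ (a + b) :: real)" for a b
    using binomial_fact[of b "a + b", where 'a = real] binomial_le_pow2[of "a + b" b]
    by (simp add: mult.commute flip: of_nat_le_iff[where 'a = real])
  consider "p \<le> m" | "m < p" "p \<le> 2 * m" | "2 * m < p"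
    by linarith
  then show ?thesis
  proof cases
    case 1
    define q where "q = m - p"
    have eq: "2 * int m - int p = int (q + m)" "int p - int m = - int q"
      using 1 by (auto simp: q_def)
    have "fact (q + m) / (fact q * fact m) \<le> (2 ^ (q + m) :: real)"
      by (rule choose_le)
    also have "\<dots> \<le> 2 ^ (2 * m) * 2 ^ p"
      unfolding power_add[symmetric] using 1 by (intro power_increasing) (auto simp: q_def)
    also have "\<dots> = 4 ^ m * 2 ^ p"
      by (simp add: power_mult)
    finally show ?thesis
      unfolding eq int_fact_of_nat int_fact_minus_of_nat by (simp add: field_simps)
  next
    case 2
    define a b where "a = 2 * m - p" and "b = p - m"
    have eq: "2 * int m - int p = int a" "int p - int m = int b" "m = a + b"
      using 2 by (auto simp: a_def b_def)
    have "(fact a * fact b :: real) \<le> fact (a + b)"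
    proof -
      have "fact a * fact b dvd (fact (a + b) :: nat)"
        by (rule fact_fact_dvd_fact)
      then have "fact a * fact b \<le> (fact (a + b) :: nat)"
        by (simp add: dvd_imp_le)
      then have "of_nat (fact a * fact b) \<le> (of_nat (fact (a + b)) :: real)"
        by (rule of_nat_mono)
      then show ?thesis by simp
    qed
    then have "(fact a * fact b) / fact m \<le> (1 :: real)"
      by (simp add: eq(3))
    moreover have "(1 :: real) \<le> 4 ^ m * 2 ^ p"
      using mult_mono[of 1 "4 ^ m" 1 "2 ^ p :: real"] by simp
    ultimately have "(fact a * fact b) / fact m \<le> (4 ^ m * 2 ^ p :: real)"
      by (rule order_trans)
    then have "(fact a * fact b) / fact m / fact p \<le> (4 ^ m * 2 ^ p / fact p :: real)"
      by (rule divide_right_mono) simp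
    then show ?thesis
      unfolding eq(1,2) int_fact_of_nat by (simp add: field_simps)
  next
    case 3
    define q where "q = p - 2 * m"
    have eq: "2 * int m - int p = - int q" "int p - int m = int (q + m)"
      using 3 by (auto simp: q_def)
    have "fact (q + m) / (fact q * fact m) \<le> (2 ^ (q + m) :: real)"
      by (rule choose_le)
    also have "\<dots> \<le> 2 ^ p"
      using 3 by (intro power_increasing) (auto simp: q_def)
    also have "\<dots> \<le> 4 ^ m * 2 ^ p"
      by simp
    finally show ?thesis
      unfolding eq int_fact_of_nat int_fact_minus_of_nat by (simp add: field_simps)
  qed
qed

text \<open>For \<open>k \<ge> 0\<close> this is the binomial series of \<open>(1 - \<tau>)\<close> to the power \<open>-k - 1\<close>. For \<open>k = -q < 0\<close> the terms with
  \<open>n \<le> q\<close> form the finite binomial expansion of \<open>(1 + \<tau>)\<^sup>q / q!\<close>, and the later ones are dominated by a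
  geometric series over \<open>q!\<close>.\<close>

lemma int_fact_series:
  assumes \<tau>: "0 \<le> \<tau>" "\<tau> < 1"
  shows "\<exists>S. ((\<lambda>n. \<tau> ^ n * int_fact (k + int n) / fact n) has_sum S) UNIV \<and>
    S \<le> 2 / (1 - \<tau>) * (if 0 \<le> k then (1 / (1 - \<tau>)) ^ nat k else (1 + \<tau>) ^ nat (- k)) * int_fact k"
proof (cases "0 \<le> k")
  case True
  then obtain j where j: "k = int j" by (metis nonneg_int_cases)
  have "(\<lambda>n. (- real (Suc j) gchoose n) * (- \<tau>) ^ n) sums (1 + (- \<tau>)) powr (- real (Suc j))"
    using \<tau> by (intro gen_binomial_real) auto
  then have "(\<lambda>n. fact j * ((- real (Suc j) gchoose n) * (- \<tau>) ^ n))
      sums (fact j * (1 + (- \<tau>)) powr (- real (Suc j)))"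
    by (rule sums_mult)
  moreover have "fact j * ((- real (Suc j) gchoose n) * (- \<tau>) ^ n)
      = \<tau> ^ n * int_fact (k + int n) / fact n" for n
  proof -
    have "(- real (Suc j) gchoose n) = (-1) ^ n * (real (j + n) gchoose n)"
      by (subst gbinomial_minus) (simp add: algebra_simps)
    also have "real (j + n) gchoose n = fact (j + n) / (fact n * fact j)"
      unfolding binomial_gbinomial[symmetric] by (simp add: binomial_fact)
    finally have *: "(- real (Suc j) gchoose n) = (-1) ^ n * (fact (j + n) / (fact n * fact j))" .
    have "int_fact (k + int n) = fact (j + n)"
      unfolding j by (metis int_fact_of_nat of_nat_add)
    moreover have "(-1) ^ n * (- \<tau>) ^ n = \<tau> ^ n"
      by (simp flip: power_mult_distrib)
    ultimately show ?thesis
      unfolding * by (simp add: field_simps)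
  qed
  ultimately have sums: "(\<lambda>n. \<tau> ^ n * int_fact (k + int n) / fact n) sums
      (fact j * (1 + (- \<tau>)) powr (- real (Suc j)))"
    by simp
  show ?thesis
  proof (intro exI conjI)
    show "((\<lambda>n. \<tau> ^ n * int_fact (k + int n) / fact n) has_sum
        (fact j * (1 + (- \<tau>)) powr (- real (Suc j)))) UNIV"
      using \<tau> by (intro sums_nonneg_imp_has_sum[OF sums]) (simp add: less_imp_le)
    have "(1 + (- \<tau>)) powr (- real (Suc j)) = (1 / (1 - \<tau>)) * (1 / (1 - \<tau>)) ^ j"
      using \<tau> by (simp only: powr_minus powr_realpow) (simp add: field_simps)
    moreover have "\<dots> \<le> 2 / (1 - \<tau>) * (1 / (1 - \<tau>)) ^ j"
      using \<tau> by (intro mult_right_mono divide_right_mono) auto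
    ultimately have "(1 + (- \<tau>)) powr (- real (Suc j)) \<le> 2 / (1 - \<tau>) * (1 / (1 - \<tau>)) ^ j"
      by (rule ord_eq_le_trans)
    then have "fact j * (1 + (- \<tau>)) powr (- real (Suc j)) \<le> fact j * (2 / (1 - \<tau>) * (1 / (1 - \<tau>)) ^ j)"
      by (rule mult_left_mono) simp
    then show "fact j * (1 + (- \<tau>)) powr (- real (Suc j))
      \<le> 2 / (1 - \<tau>) * (if 0 \<le> k then (1 / (1 - \<tau>)) ^ nat k else (1 + \<tau>) ^ nat (- k)) * int_fact k"
      using j by (simp add: mult.commute)
  qed
next
  case False
  define q where "q = nat (- k)"
  have k: "k = - int q" "q > 0"
    using False by (auto simp: q_def)
  \<comment> \<open>The first summand is exact for \<open>n \<le> q\<close>; the second dominates the tail \<open>n > q\<close>.\<close>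
  define b where "b n = (if n \<le> q then of_nat (q choose n) * \<tau> ^ n / fact q else 0) + \<tau> ^ n / fact q" for n
  have le: "\<tau> ^ n * int_fact (k + int n) / fact n \<le> b n" for n
  proof (cases "n \<le> q")
    case True
    then have "k + int n = - int (q - n)"
      by (simp add: k of_nat_diff)
    then have *: "int_fact (k + int n) = 1 / fact (q - n)"
      by (simp add: int_fact_minus_of_nat)
    then have "\<tau> ^ n * int_fact (k + int n) / fact n = of_nat (q choose n) * \<tau> ^ n / fact q"
      unfolding * binomial_fact[OF True, where 'a = real] by simp
    then show ?thesis
      using True \<tau> by (simp add: b_def)
  next
    case False
    then have eq: "k + int n = int (n - q)"
      by (simp add: k of_nat_diff)
    have "fact q * fact (n - q) dvd (fact n :: nat)"
      using fact_fact_dvd_fact[of q "n - q"] False by simp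
    then have "fact q * fact (n - q) \<le> (fact n :: nat)"
      by (simp add: dvd_imp_le)
    then have "of_nat (fact q * fact (n - q)) \<le> (of_nat (fact n) :: real)"
      by (rule of_nat_mono)
    then have "fact q * fact (n - q) \<le> (fact n :: real)"
      by simp
    then have "fact (n - q) / fact n \<le> (1 / fact q :: real)"
      by (simp add: field_simps)
    then have "\<tau> ^ n * (fact (n - q) / fact n) \<le> \<tau> ^ n * (1 / fact q)"
      using \<tau> by (intro mult_left_mono) auto
    then show ?thesis
      using False \<tau> unfolding eq b_def int_fact_of_nat by simp
  qed
  have b: "(b has_sum ((1 + \<tau>) ^ q / fact q + 1 / (1 - \<tau>) / fact q)) UNIV"
    unfolding b_def
  proof (rule has_sum_add)
    have "(\<lambda>n. \<tau> ^ n / fact q) sums (1 / (1 - \<tau>) / fact q)"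
      using \<tau> by (intro sums_divide geometric_sums) auto
    then show "((\<lambda>n. \<tau> ^ n / fact q) has_sum (1 / (1 - \<tau>) / fact q)) UNIV"
      using \<tau> by (intro sums_nonneg_imp_has_sum) auto
    have "((\<lambda>n. of_nat (q choose n) * \<tau> ^ n / fact q) has_sum ((1 + \<tau>) ^ q / fact q)) {..q}"
      by (rule has_sum_finiteI)
        (simp_all add: binomial_ring[of \<tau> 1] add.commute[of 1] flip: sum_divide_distrib)
    then show "((\<lambda>n. if n \<le> q then of_nat (q choose n) * \<tau> ^ n / fact q else 0)
        has_sum ((1 + \<tau>) ^ q / fact q)) UNIV"
      by (rule has_sum_cong_neutral[THEN iffD1, rotated -1]) auto
  qed
  have summ: "(\<lambda>n. \<tau> ^ n * int_fact (k + int n) / fact n) summable_on UNIV"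
    using le \<tau> has_sum_imp_summable[OF b]
    by (rule_tac summable_on_comparison_test) (auto simp: less_imp_le)
  show ?thesis
  proof (intro exI conjI, rule has_sum_infsum[OF summ])
    have "infsum (\<lambda>n. \<tau> ^ n * int_fact (k + int n) / fact n) UNIV
        \<le> (1 + \<tau>) ^ q / fact q + 1 / (1 - \<tau>) / fact q"
      using has_sum_mono[OF has_sum_infsum[OF summ] b] le by blast
    also have "\<dots> = ((1 + \<tau>) ^ q + 1 / (1 - \<tau>)) / fact q"
      by (simp add: add_divide_distrib)
    also have "\<dots> \<le> (2 / (1 - \<tau>) * (1 + \<tau>) ^ q) / fact q"
    proof (rule divide_right_mono)
      have "1 \<le> (1 + \<tau>) ^ q" "1 \<le> 1 / (1 - \<tau>)"
        using \<tau> by auto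
      then have "1 * (1 + \<tau>) ^ q \<le> 1 / (1 - \<tau>) * (1 + \<tau>) ^ q"
        "1 / (1 - \<tau>) * 1 \<le> 1 / (1 - \<tau>) * (1 + \<tau>) ^ q"
        using \<tau> by (intro mult_mono; simp)+
      then show "(1 + \<tau>) ^ q + 1 / (1 - \<tau>) \<le> 2 / (1 - \<tau>) * (1 + \<tau>) ^ q"
        by (simp add: field_simps)
    qed simp
    finally show "infsum (\<lambda>n. \<tau> ^ n * int_fact (k + int n) / fact n) UNIV \<le>
      2 / (1 - \<tau>) * (if 0 \<le> k then (1 / (1 - \<tau>)) ^ nat k else (1 + \<tau>) ^ nat (- k)) * int_fact k"
      using k by (simp add: int_fact_minus_of_nat)
  qed
qed

section \<open>Absolute convergence of the Horn series\<close>

lemma summable_power_times_exp: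
  fixes a b c :: real
  assumes "0 \<le> a" "a < 1" "0 \<le> b"
  shows "(\<lambda>(m, p). c * a ^ m * (b ^ p / fact p)) summable_on (UNIV :: (nat \<times> nat) set)"
proof -
  have "(\<lambda>m. a ^ m) summable_on UNIV"
    using assms by (intro summable_nonneg_imp_summable_on summable_geometric) auto
  moreover have "(\<lambda>p. b ^ p / fact p) summable_on UNIV"
    using assms summable_exp[of b]
    by (intro summable_nonneg_imp_summable_on) (auto simp: divide_inverse mult.commute)
  ultimately have "(\<lambda>(m, p). a ^ m * (b ^ p / fact p)) summable_on UNIV \<times> UNIV"
    using assms
    by (intro summable_on_SigmaI[where g = "\<lambda>m. a ^ m * infsum (\<lambda>p. b ^ p / fact p) UNIV"]
        summable_on_cmult_left)
      (simp_all add: has_sum_cmult_right del: times_divide_eq_right)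
  then have "(\<lambda>(m, p). a ^ m * (b ^ p / fact p)) summable_on UNIV"
    by simp
  from summable_on_cmult_right[OF this, of c] show ?thesis
    by (simp add: case_prod_unfold mult.assoc)
qed

definition hornH8_term :: "complex^'d^'d \<Rightarrow> complex^'d^'d \<Rightarrow> complex \<Rightarrow> complex \<Rightarrow> nat \<times> nat \<Rightarrow> complex^'d^'d"
  where "hornH8_term A B x y = (\<lambda>(m, p). (x ^ m * y ^ p / (fact m * fact p)) *\<^sub>M
    (mpoch_int A (2 * int m - int p) ** mpoch_int B (int p - int m)))"

lemma hornH8_eq_infsum: "hornH8 A B x y = infsum (hornH8_term A B x y) UNIV"
  by (simp add: hornH8_def hornH8_term_def)

lemma norm_mpoch_int_product_le:
  fixes A B :: "complex^'d^'d"
  assumes "mpoch_int_defined A" "mpoch_int_defined B" and r: "1 < r"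
  shows "\<exists>C\<ge>0. \<forall>k l. norm (mpoch_int A k ** mpoch_int B l) \<le>
    C * r ^ (nat \<bar>k\<bar> + nat \<bar>l\<bar>) * int_fact k * int_fact l"
proof -
  obtain C where C: "0 \<le> C" "\<And>k. norm (mpoch_int A k) \<le> C * r ^ nat \<bar>k\<bar> * int_fact k"
    using norm_mpoch_int_le[OF assms(1) r] by blast
  obtain D where D: "0 \<le> D" "\<And>k. norm (mpoch_int B k) \<le> D * r ^ nat \<bar>k\<bar> * int_fact k"
    using norm_mpoch_int_le[OF assms(2) r] by blast
  obtain K where K: "\<And>(X :: complex^'d^'d) (Y :: complex^'d^'d). norm (X ** Y) \<le> norm X * norm Y * K" "K \<ge> 0"
    using bounded_bilinear.nonneg_bounded[OF bounded_bilinear_matrix_mult[where 'd = 'd]] by blast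
  show ?thesis
  proof (intro exI conjI allI)
    show "0 \<le> C * D * K" using C D K by simp
    fix k l
    have "norm (mpoch_int A k ** mpoch_int B l) \<le> norm (mpoch_int A k) * norm (mpoch_int B l) * K"
      by (rule K)
    also have "\<dots> \<le> (C * r ^ nat \<bar>k\<bar> * int_fact k) * (D * r ^ nat \<bar>l\<bar> * int_fact l) * K"
      using C(1) r K(2)
      by (intro mult_right_mono mult_mono C(2) D(2)) (auto simp: less_imp_le)
    also have "\<dots> = C * D * K * r ^ (nat \<bar>k\<bar> + nat \<bar>l\<bar>) * int_fact k * int_fact l"
      by (simp add: power_add mult_ac)
    finally show "norm (mpoch_int A k ** mpoch_int B l) \<le>
      C * D * K * r ^ (nat \<bar>k\<bar> + nat \<bar>l\<bar>) * int_fact k * int_fact l" .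
  qed
qed

lemma norm_hornH8_term:
  "norm (hornH8_term A B x y (m, p)) = norm x ^ m * norm y ^ p / (fact m * fact p) *
    norm (mpoch_int A (2 * int m - int p) ** mpoch_int B (int p - int m))"
  by (simp add: hornH8_term_def norm_cscale norm_mult norm_divide norm_power)

text \<open>Strict inequalities that hold without the growth factor \<open>r\<close>, that is at \<open>r = 1\<close>, survive for some
  \<open>r > 1\<close>.\<close>

lemma exists_gt_one_less_one:
  fixes f :: "real \<Rightarrow> real"
  assumes "isCont f 1" "f 1 < 1" "isCont g 1" "g 1 < (1::real)"
  obtains r where "1 < r" "f r < 1" "g r < 1"
proof -
  have "eventually (\<lambda>r. f r < 1) (at_right 1)" "eventually (\<lambda>r. g r < 1) (at_right 1)"
    using assms
    by (auto intro!: order_tendstoD(2) simp: isCont_def filterlim_at_split)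
  then have ev: "eventually (\<lambda>r. f r < 1 \<and> g r < 1 \<and> 1 < r) (at_right (1::real))"
    using eventually_at_right_less[of "1::real"] by eventually_elim simp
  obtain r where "f r < 1 \<and> g r < 1 \<and> 1 < r"
    using eventually_happens'[OF trivial_limit_at_right_real ev] by blast
  then show thesis using that by blast
qed

text \<open>The double series is treated with a weight \<open>w\<close>, because summing a third index first (below) leaves
  a weight that is geometric in \<open>m\<close> and \<open>p\<close>. The factor \<open>v\<^sup>p\<close> is harmless on account of the \<open>1 / p!\<close>;
  only \<open>u\<close> restricts \<open>X\<close>.\<close>

lemma weighted_double_series_summable:
  fixes w :: "nat \<Rightarrow> nat \<Rightarrow> real"
  assumes pos: "0 \<le> C" "0 \<le> X" "0 \<le> Y" "0 \<le> u" "0 \<le> v" and X: "4 * X * u < 1"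
    and w: "\<And>m p. 0 \<le> w m p" "\<And>m p. w m p \<le> u ^ m * v ^ p"
  shows "(\<lambda>(m, p). C * (X ^ m * Y ^ p / (fact m * fact p)) * w m p *
    (int_fact (2 * int m - int p) * int_fact (int p - int m))) summable_on UNIV"
proof (rule summable_on_comparison_test)
  show "(\<lambda>(m, p). C * (4 * X * u) ^ m * ((2 * Y * v) ^ p / fact p)) summable_on UNIV"
    using X pos by (intro summable_power_times_exp) auto
  have "C * (X ^ m * Y ^ p / (fact m * fact p)) * w m p *
      (int_fact (2 * int m - int p) * int_fact (int p - int m))
    \<le> C * (4 * X * u) ^ m * ((2 * Y * v) ^ p / fact p)" for m p
  proof -
    have "C * (X ^ m * Y ^ p / (fact m * fact p)) * w m p *
        (int_fact (2 * int m - int p) * int_fact (int p - int m))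
      = C * X ^ m * Y ^ p * (w m p *
        (int_fact (2 * int m - int p) * int_fact (int p - int m) / (fact m * fact p)))"
      by simp
    also have "\<dots> \<le> C * X ^ m * Y ^ p * ((u ^ m * v ^ p) * (4 ^ m * 2 ^ p / fact p))"
      using pos by (intro mult_left_mono mult_mono w int_fact_mult_le) (auto simp: less_imp_le)
    also have "\<dots> = C * (4 * X * u) ^ m * ((2 * Y * v) ^ p / fact p)"
      by (simp add: power_mult_distrib)
    finally show ?thesis .
  qed
  then show "(case q of (m, p) \<Rightarrow> C * (X ^ m * Y ^ p / (fact m * fact p)) * w m p *
      (int_fact (2 * int m - int p) * int_fact (int p - int m)))
    \<le> (case q of (m, p) \<Rightarrow> C * (4 * X * u) ^ m * ((2 * Y * v) ^ p / fact p))" for q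
    by (cases q) simp
  show "0 \<le> (case q of (m, p) \<Rightarrow> C * (X ^ m * Y ^ p / (fact m * fact p)) * w m p *
      (int_fact (2 * int m - int p) * int_fact (int p - int m)))" for q
    using pos w(1) by (cases q) (auto simp: less_imp_le)
qed

text \<open>The indices of the two Pochhammer symbols are linear in \<open>n\<close>, \<open>m\<close> and \<open>p\<close>, so the growth factor merely
  rescales \<open>t\<close>, \<open>x\<close> and \<open>y\<close> by powers of \<open>r\<close>.\<close>

lemma power_shifted_index_le:
  assumes "1 < (r :: real)"
  shows "r ^ (nat \<bar>int n + (2 * int m - int p)\<bar> + nat \<bar>int p - int m\<bar>) \<le> r ^ n * (r ^ 3) ^ m * (r ^ 2) ^ p"
    and "r ^ (nat \<bar>2 * int m - int p\<bar> + nat \<bar>int n + (int p - int m)\<bar>) \<le> r ^ n * (r ^ 3) ^ m * (r ^ 2) ^ p"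
proof -
  have "r ^ (nat \<bar>int n + (2 * int m - int p)\<bar> + nat \<bar>int p - int m\<bar>) \<le> r ^ (n + 3 * m + 2 * p)"
    "r ^ (nat \<bar>2 * int m - int p\<bar> + nat \<bar>int n + (int p - int m)\<bar>) \<le> r ^ (n + 3 * m + 2 * p)"
    using assms by (intro power_increasing; simp)+
  then show "r ^ (nat \<bar>int n + (2 * int m - int p)\<bar> + nat \<bar>int p - int m\<bar>) \<le> r ^ n * (r ^ 3) ^ m * (r ^ 2) ^ p"
    and "r ^ (nat \<bar>2 * int m - int p\<bar> + nat \<bar>int n + (int p - int m)\<bar>) \<le> r ^ n * (r ^ 3) ^ m * (r ^ 2) ^ p"
    by (simp_all only: power_add power_mult)
qed

text \<open>One summable majorant serves a whole polydisc. Besides absolute convergence, this uniformity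
  yields holomorphy of the Horn function by the Weierstrass test.\<close>

lemma hornH8_term_majorant:
  fixes A B :: "complex^'d^'d"
  assumes "mpoch_int_defined A" "mpoch_int_defined B" and X: "0 \<le> X" "X < 1 / 4" and Y: "0 \<le> Y"
  shows "\<exists>b. b summable_on UNIV \<and>
    (\<forall>x y q. norm x \<le> X \<longrightarrow> norm y \<le> Y \<longrightarrow> norm (hornH8_term A B x y q) \<le> b q)"
proof -
  obtain r where r: "1 < r" "4 * X * r ^ 3 < 1"
    using exists_gt_one_less_one[of "\<lambda>r. 4 * X * r ^ 3" "\<lambda>_. 0"] X by auto
  obtain C where C: "0 \<le> C" "\<And>k l. norm (mpoch_int A k ** mpoch_int B l) \<le>
    C * r ^ (nat \<bar>k\<bar> + nat \<bar>l\<bar>) * int_fact k * int_fact l"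
    using norm_mpoch_int_product_le[OF assms(1,2) r(1)] by blast
  define b where "b = (\<lambda>(m, p). C * ((X * r ^ 3) ^ m * (Y * r ^ 2) ^ p / (fact m * fact p)) * 1 *
    (int_fact (2 * int m - int p) * int_fact (int p - int m)))"
  have "norm (hornH8_term A B x y (m, p)) \<le> b (m, p)"
    if xy: "norm x \<le> X" "norm y \<le> Y" for x y m p
  proof -
    let ?k = "2 * int m - int p" and ?l = "int p - int m"
    have "norm (hornH8_term A B x y (m, p)) \<le> X ^ m * Y ^ p / (fact m * fact p) *
        (C * r ^ (nat \<bar>?k\<bar> + nat \<bar>?l\<bar>) * int_fact ?k * int_fact ?l)"
      unfolding norm_hornH8_term using xy X Y
      by (intro mult_mono divide_right_mono power_mono C(2)) auto
    also have "\<dots> \<le> X ^ m * Y ^ p / (fact m * fact p) *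
        (C * ((r ^ 3) ^ m * (r ^ 2) ^ p) * int_fact ?k * int_fact ?l)"
      using X Y C(1) power_shifted_index_le(1)[OF r(1), of 0 m p]
      by (intro mult_left_mono mult_right_mono) (auto simp: less_imp_le)
    also have "\<dots> = b (m, p)"
      by (simp add: b_def power_mult_distrib mult_ac)
    finally show ?thesis .
  qed
  moreover have "b summable_on UNIV"
    unfolding b_def using r X Y C(1)
    by (intro weighted_double_series_summable[where u = 1 and v = 1]) (auto simp: mult_ac)
  ultimately show ?thesis
    by (intro exI[of _ b]) auto
qed

lemma hornH8_term_abs_summable:
  assumes "mpoch_int_defined A" "mpoch_int_defined B" "norm x < 1 / 4"
  shows "(\<lambda>q. norm (hornH8_term A B x y q)) summable_on UNIV"
proof -
  obtain b where "b summable_on UNIV"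
    "\<And>x' y' q. norm x' \<le> norm x \<Longrightarrow> norm y' \<le> norm y \<Longrightarrow> norm (hornH8_term A B x' y' q) \<le> b q"
    using hornH8_term_majorant[OF assms(1,2) norm_ge_zero assms(3) norm_ge_zero[of y]] by blast
  then show ?thesis
    by (intro Infinite_Sum.abs_summable_on_comparison_test'[of b]) auto
qed

lemma has_sum_hornH8:
  assumes "mpoch_int_defined A" "mpoch_int_defined B" "norm x < 1 / 4"
  shows "(hornH8_term A B x y has_sum hornH8 A B x y) UNIV"
  unfolding hornH8_eq_infsum
  using abs_summable_summable[OF hornH8_term_abs_summable[OF assms]] by (rule has_sum_infsum)

section \<open>Absolute convergence of the triple series\<close>

text \<open>Up to a constant, a bound for the factor by which summation over the shift \<open>n\<close> enlarges the scalar
  size at index \<open>k\<close>.\<close>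

definition shift_weight :: "real \<Rightarrow> int \<Rightarrow> real"
  where "shift_weight \<tau> k = (if 0 \<le> k then (1 / (1 - \<tau>)) ^ nat k else (1 + \<tau>) ^ nat (- k))"

text \<open>Summing over \<open>n\<close> first reproduces the scalar size at index \<open>k\<close>, up to a constant and the weight, so
  a shift in one Pochhammer symbol reduces the triple series to a double series.\<close>

lemma abs_summable_shifted:
  fixes a :: "nat \<times> nat \<Rightarrow> real" and k :: "nat \<times> nat \<Rightarrow> int" and F :: "(nat \<times> nat) \<times> nat \<Rightarrow> 'v :: banach"
  assumes \<tau>: "0 \<le> \<tau>" "\<tau> < 1"
    and le: "\<And>q n. norm (F (q, n)) \<le> a q * (\<tau> ^ n * int_fact (k q + int n) / fact n)"
    and a: "\<And>q. 0 \<le> a q"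
    and summ: "(\<lambda>q. a q * (shift_weight \<tau> (k q) * int_fact (k q))) summable_on UNIV"
  shows "(\<lambda>q. norm (F q)) summable_on UNIV \<times> UNIV"
proof -
  define S where "S q = infsum (\<lambda>n. \<tau> ^ n * int_fact (k q + int n) / fact n) UNIV" for q
  have S: "((\<lambda>n. \<tau> ^ n * int_fact (k q + int n) / fact n) has_sum S q) UNIV"
    "S q \<le> 2 / (1 - \<tau>) * shift_weight \<tau> (k q) * int_fact (k q)" for q
    using int_fact_series[OF \<tau>, of "k q"] unfolding S_def shift_weight_def
    by (auto simp: infsumI)
  have pos: "0 \<le> S q" for q
    using S(1) by (rule has_sum_nonneg) (use \<tau> in \<open>auto simp: less_imp_le\<close>)
  have "(\<lambda>(q, n). a q * (\<tau> ^ n * int_fact (k q + int n) / fact n)) summable_on UNIV \<times> UNIV"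
  proof (rule summable_on_SigmaI)
    show "((\<lambda>n. (\<lambda>(q, n). a q * (\<tau> ^ n * int_fact (k q + int n) / fact n)) (q, n)) has_sum a q * S q) UNIV" for q
      using has_sum_cmult_right[OF S(1)] by simp
    have "(\<lambda>q. 2 / (1 - \<tau>) * (a q * (shift_weight \<tau> (k q) * int_fact (k q)))) summable_on UNIV"
      by (intro summable_on_cmult_right summ)
    then show "(\<lambda>q. a q * S q) summable_on UNIV"
    proof (rule summable_on_comparison_test)
      show "a q * S q \<le> 2 / (1 - \<tau>) * (a q * (shift_weight \<tau> (k q) * int_fact (k q)))" for q
        using mult_left_mono[OF S(2) a, of q q] by (simp add: mult_ac)
    qed (use a pos in auto)
  qed (use \<tau> a in \<open>auto simp: less_imp_le\<close>)
  then show ?thesis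
    by (rule Infinite_Sum.abs_summable_on_comparison_test') (use le in auto)
qed

lemma has_sum_exchange:
  fixes F :: "'q \<times> 'n \<Rightarrow> 'v :: banach"
  assumes abs: "(\<lambda>q. norm (F q)) summable_on UNIV \<times> UNIV"
    and H: "\<And>q. ((\<lambda>n. F (q, n)) has_sum H q) UNIV"
    and G: "\<And>n. ((\<lambda>q. F (q, n)) has_sum G n) UNIV"
    and S: "(H has_sum S) UNIV"
  shows "(G has_sum S) UNIV"
proof -
  have "(F has_sum S) (UNIV \<times> UNIV)"
    using H S abs_summable_summable[OF abs] by (intro has_sum_SigmaI[where g = H]) auto
  then have "((\<lambda>(n, q). F (q, n)) has_sum S) (UNIV \<times> UNIV)"
    by (subst (asm) has_sum_swap)
  then show ?thesis
    by (rule has_sum_SigmaD) (simp add: G)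
qed

text \<open>Covers both summation formulas: \<open>k\<close> is the index that is shifted by \<open>n\<close>, and \<open>l\<close> the other one.\<close>

lemma triple_series_abs_summable:
  fixes P :: "nat \<Rightarrow> nat \<Rightarrow> nat \<Rightarrow> complex^'d^'d" and k l :: "nat \<Rightarrow> nat \<Rightarrow> int"
  assumes r: "0 \<le> r" and C: "0 \<le> C"
    and P: "\<And>n m p. norm (P n m p) \<le> C * (r ^ n * (r ^ 3) ^ m * (r ^ 2) ^ p) *
      int_fact (k m p + int n) * int_fact (l m p)"
    and kl: "\<And>m p. int_fact (k m p) * int_fact (l m p) =
      int_fact (2 * int m - int p) * int_fact (int p - int m)"
    and w: "\<And>m p. shift_weight (r * norm t) (k m p) \<le> u ^ m * v ^ p" and uv: "0 \<le> u" "0 \<le> v"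
    and small: "r * norm t < 1" "4 * norm x * r ^ 3 * u < 1"
  shows "(\<lambda>q. norm ((\<lambda>((m, p), n). (t ^ n / fact n * (x ^ m * y ^ p / (fact m * fact p))) *\<^sub>M P n m p) q))
    summable_on UNIV \<times> UNIV"
proof (rule abs_summable_shifted[where k = "\<lambda>(m, p). k m p" and \<tau> = "r * norm t"])
  define a where "a = (\<lambda>(m, p). C * ((norm x * r ^ 3) ^ m * (norm y * r ^ 2) ^ p / (fact m * fact p)) * int_fact (l m p))"
  show "0 \<le> a q" for q
    using C r by (cases q) (auto simp: a_def less_imp_le)
  have w0: "0 \<le> shift_weight (r * norm t) (k m p)" for m p
    using r small(1) by (simp add: shift_weight_def)
  show "(\<lambda>q. a q * (shift_weight (r * norm t) (case q of (m, p) \<Rightarrow> k m p) * int_fact (case q of (m, p) \<Rightarrow> k m p))) summable_on UNIV"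
  proof -
    have "(\<lambda>(m, p). C * ((norm x * r ^ 3) ^ m * (norm y * r ^ 2) ^ p / (fact m * fact p)) *
        shift_weight (r * norm t) (k m p) * (int_fact (2 * int m - int p) * int_fact (int p - int m))) summable_on UNIV"
      using r C uv small w0 w
      by (intro weighted_double_series_summable[where u = u and v = v]) (auto simp: mult_ac)
    then show ?thesis
      unfolding kl[symmetric] by (simp add: a_def case_prod_unfold mult_ac)
  qed
  show "norm ((\<lambda>((m, p), n). (t ^ n / fact n * (x ^ m * y ^ p / (fact m * fact p))) *\<^sub>M P n m p) (q, n))
    \<le> a q * ((r * norm t) ^ n * int_fact ((case q of (m, p) \<Rightarrow> k m p) + int n) / fact n)" for q n
  proof (cases q)
    case (Pair m p)
    have "norm ((t ^ n / fact n * (x ^ m * y ^ p / (fact m * fact p))) *\<^sub>M P n m p)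
      = (norm t ^ n / fact n * (norm x ^ m * norm y ^ p / (fact m * fact p))) * norm (P n m p)"
      by (simp add: norm_cscale norm_mult norm_divide norm_power)
    also have "\<dots> \<le> (norm t ^ n / fact n * (norm x ^ m * norm y ^ p / (fact m * fact p))) *
        (C * (r ^ n * (r ^ 3) ^ m * (r ^ 2) ^ p) * int_fact (k m p + int n) * int_fact (l m p))"
      by (intro mult_left_mono P) auto
    also have "\<dots> = a q * ((r * norm t) ^ n * int_fact (k m p + int n) / fact n)"
      unfolding a_def Pair by (simp add: power_mult_distrib mult_ac)
    finally show ?thesis
      using Pair by simp
  qed
qed (use r small in auto)

text \<open>The weights that arise from shifting the first and the second symbol. The \<open>m\<close>-th powers are
  the source of the conditions \<open>4 \<bar>x\<bar> < (1 - \<bar>t\<bar>)\<^sup>2\<close> and \<open>4 \<bar>x\<bar> (1 + \<bar>t\<bar>) < 1\<close>.\<close>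

lemma shift_weight_le:
  assumes "0 \<le> \<tau>" "\<tau> < 1"
  shows "shift_weight \<tau> (2 * int m - int p) \<le> (1 / (1 - \<tau>)\<^sup>2) ^ m * 2 ^ p"
    and "shift_weight \<tau> (int p - int m) \<le> (1 + \<tau>) ^ m * (1 / (1 - \<tau>)) ^ p"
proof -
  have ge: "1 \<le> 1 / (1 - \<tau>)"
    using assms by simp
  have up: "(1 / (1 - \<tau>)) ^ i \<le> (1 / (1 - \<tau>)) ^ j" if "i \<le> j" for i j
    using ge that by (rule power_increasing[rotated])
  have dn: "(1 + \<tau>) ^ i \<le> (1 + \<tau>) ^ j" if "i \<le> j" for i j
    using assms that by (intro power_increasing) auto
  show "shift_weight \<tau> (2 * int m - int p) \<le> (1 / (1 - \<tau>)\<^sup>2) ^ m * 2 ^ p"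
  proof (cases "0 \<le> 2 * int m - int p")
    case True
    have "(1 / (1 - \<tau>)) ^ nat (2 * int m - int p) \<le> (1 / (1 - \<tau>)) ^ (2 * m)"
      by (intro up) auto
    also have "\<dots> = (1 / (1 - \<tau>)\<^sup>2) ^ m * 1"
      by (simp add: power_mult power_one_over)
    also have "\<dots> \<le> (1 / (1 - \<tau>)\<^sup>2) ^ m * 2 ^ p"
      by (intro mult_left_mono) auto
    finally show ?thesis using True by (simp add: shift_weight_def)
  next
    case False
    have "(1 + \<tau>) ^ nat (- (2 * int m - int p)) \<le> (1 + \<tau>) ^ p"
      by (intro dn) auto
    also have "\<dots> \<le> 2 ^ p"
      using assms by (intro power_mono) auto
    also have "2 ^ p = 1 ^ m * (2 :: real) ^ p"
      by simp
    also have "\<dots> \<le> (1 / (1 - \<tau>)\<^sup>2) ^ m * 2 ^ p"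
      using one_le_power[OF ge, of 2] by (intro mult_right_mono power_mono) (auto simp: power_one_over)
    finally show ?thesis using False by (simp add: shift_weight_def)
  qed
  show "shift_weight \<tau> (int p - int m) \<le> (1 + \<tau>) ^ m * (1 / (1 - \<tau>)) ^ p"
  proof (cases "0 \<le> int p - int m")
    case True
    have "1 * (1 / (1 - \<tau>)) ^ nat (int p - int m) \<le> (1 + \<tau>) ^ m * (1 / (1 - \<tau>)) ^ p"
      using assms by (intro mult_mono up) (auto simp: one_le_power)
    then show ?thesis using True by (simp add: shift_weight_def)
  next
    case False
    have "(1 + \<tau>) ^ nat (- (int p - int m)) * 1 \<le> (1 + \<tau>) ^ m * (1 / (1 - \<tau>)) ^ p"
      using assms one_le_power[OF ge] by (intro mult_mono dn) auto
    then show ?thesis using False by (simp add: shift_weight_def)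
  qed
qed

section \<open>The binomial series with a shifted index\<close>

lemma shifted_series_abs_summable:
  fixes M :: "complex^'d^'d"
  assumes def: "mpoch_int_defined M" and t: "norm t < 1"
  shows "summable (\<lambda>n. norm ((t ^ n / fact n) *\<^sub>M mpoch_int M (int n + k)))"
proof -
  obtain r where r: "1 < r" "norm t * r < 1"
    using exists_gt_one_less_one[of "\<lambda>r. norm t * r" "\<lambda>_. 0"] t by auto
  obtain C where C: "0 \<le> C" "\<And>k. norm (mpoch_int M k) \<le> C * r ^ nat \<bar>k\<bar> * int_fact k"
    using norm_mpoch_int_le[OF def r(1)] by blast
  obtain S where "((\<lambda>n. (norm t * r) ^ n * int_fact (k + int n) / fact n) has_sum S) UNIV"
    using int_fact_series[of "norm t * r" k] r by auto
  then have "summable (\<lambda>n. (C * r ^ nat \<bar>k\<bar>) * ((norm t * r) ^ n * int_fact (k + int n) / fact n))"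
    by (intro summable_mult) (auto dest: has_sum_imp_sums sums_summable)
  then show ?thesis
  proof (rule summable_comparison_test'[where N = 0])
    fix n
    have "norm ((t ^ n / fact n) *\<^sub>M mpoch_int M (int n + k))
        = norm t ^ n / fact n * norm (mpoch_int M (int n + k))"
      by (simp add: norm_cscale norm_divide norm_power)
    also have "\<dots> \<le> norm t ^ n / fact n * (C * r ^ nat \<bar>int n + k\<bar> * int_fact (int n + k))"
      by (intro mult_left_mono C(2)) auto
    also have "\<dots> \<le> norm t ^ n / fact n * (C * r ^ (nat \<bar>k\<bar> + n) * int_fact (int n + k))"
      using C(1) r(1)
      by (intro mult_left_mono mult_right_mono power_increasing) (auto simp: less_imp_le)
    also have "\<dots> = (C * r ^ nat \<bar>k\<bar>) * ((norm t * r) ^ n * int_fact (k + int n) / fact n)"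
      by (simp add: power_add power_mult_distrib add.commute)
    finally show "norm (norm ((t ^ n / fact n) *\<^sub>M mpoch_int M (int n + k)))
      \<le> (C * r ^ nat \<bar>k\<bar>) * ((norm t * r) ^ n * int_fact (k + int n) / fact n)"
      by simp
  qed
qed

lemma invertible_cscale:
  fixes N :: "complex^'d^'d"
  assumes "invertible N" "c \<noteq> 0"
  shows "invertible (c *\<^sub>M N)"
proof -
  have "((1 / c) *\<^sub>M matrix_inv N) ** (c *\<^sub>M N) = mat 1"
    using assms by (simp add: cscale_mult_left cscale_mult_right matrix_inv_left)
  then show ?thesis
    using invertible_left_inverse by blast
qed

text \<open>Let \<open>\<phi>(k)\<close> be the sum. Splitting the last factor of \<open>(M)\<^sub>n\<^sub>+\<^sub>k\<^sub>+\<^sub>1\<close> as \<open>(M + k I) + n I\<close> gives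
  \<open>\<phi>(k + 1) = \<phi>(k) (M + k I) + t \<phi>(k + 1)\<close>, since the factor \<open>n\<close> shifts the series by one term. Hence \<open>\<phi>\<close>
  satisfies the recurrence with factors \<open>(M + k I) / (1 - t)\<close>, as does the right-hand side, and they
  agree at \<open>k = 0\<close> by definition.\<close>

lemma shifted_binomial_series:
  fixes M :: "complex^'d^'d"
  assumes def: "mpoch_int_defined M" and t: "norm t < 1"
  shows "((\<lambda>n. (t ^ n / fact n) *\<^sub>M mpoch_int M (int n + k)) has_sum
    (1 - t) powi (- k) *\<^sub>M (one_minus_powr_neg t M ** mpoch_int M k)) UNIV"
proof -
  define f where "f k n = (t ^ n / fact n) *\<^sub>M mpoch_int M (int n + k)" for k n
  define \<phi> where "\<phi> k = suminf (f k)" for k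
  have f: "f k sums \<phi> k" for k
    unfolding \<phi>_def f_def
    by (intro summable_sums summable_norm_cancel[OF shifted_series_abs_summable[OF def t]])
  have t1: "1 - t \<noteq> 0"
    using t by auto
  interpret mult: bounded_bilinear "(**) :: complex^'d^'d \<Rightarrow> complex^'d^'d \<Rightarrow> complex^'d^'d"
    by (rule bounded_bilinear_matrix_mult)
  have rec: "\<phi> (k + 1) = \<phi> k ** ((1 / (1 - t)) *\<^sub>M (M + mat (of_int k)))" for k
  proof -
    have "(\<lambda>n. f k n ** (M + mat (of_int k))) sums (\<phi> k ** (M + mat (of_int k)))"
      using mult.bounded_linear_left f by (rule bounded_linear.sums)
    moreover have "(\<lambda>n. of_nat n *\<^sub>M f k n) sums (t *\<^sub>M \<phi> (k + 1))"
    proof -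
      have "of_nat (Suc n) *\<^sub>M f k (Suc n) = t *\<^sub>M f (k + 1) n" for n
      proof -
        have "of_nat (Suc n) * (t ^ Suc n / fact (Suc n)) = t * (t ^ n / fact n)"
          unfolding fact_Suc by (simp del: of_nat_Suc)
        moreover have "int (Suc n) + k = int n + (k + 1)"
          by simp
        ultimately show ?thesis
          unfolding f_def by (simp only: cscale_cscale)
      qed
      moreover have "(\<lambda>n. t *\<^sub>M f (k + 1) n) sums (t *\<^sub>M \<phi> (k + 1))"
        using bounded_linear_cscale f by (rule bounded_linear.sums)
      ultimately have "(\<lambda>n. of_nat (Suc n) *\<^sub>M f k (Suc n)) sums (t *\<^sub>M \<phi> (k + 1))"
        by simp
      then have "(\<lambda>n. of_nat n *\<^sub>M f k n) sums (t *\<^sub>M \<phi> (k + 1) + of_nat 0 *\<^sub>M f k 0)"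
        by (rule sums_Suc[where f = "\<lambda>n. of_nat n *\<^sub>M f k n"])
      moreover have "of_nat 0 *\<^sub>M f k 0 = 0"
        by (simp add: vec_eq_iff)
      ultimately show ?thesis by simp
    qed
    ultimately have "(\<lambda>n. f k n ** (M + mat (of_int k)) + of_nat n *\<^sub>M f k n)
        sums (\<phi> k ** (M + mat (of_int k)) + t *\<^sub>M \<phi> (k + 1))"
      by (rule sums_add)
    moreover have "f k n ** (M + mat (of_int k)) + of_nat n *\<^sub>M f k n = f (k + 1) n" for n
    proof -
      have "mpoch_int M (int n + (k + 1)) = mpoch_int M (int n + k) ** (M + mat (of_int (int n + k)))"
        using mpoch_int_add_one[OF def, of "int n + k"] by (simp add: add.assoc)
      also have "\<dots> = mpoch_int M (int n + k) ** (M + mat (of_int k)) + of_nat n *\<^sub>M mpoch_int M (int n + k)"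
        by (simp add: matrix_add_ldistrib mult_mat_right cscale_add_left)
      finally show ?thesis
        by (simp add: f_def cscale_mult_left cscale_add_right mult.commute)
    qed
    ultimately have "f (k + 1) sums (\<phi> k ** (M + mat (of_int k)) + t *\<^sub>M \<phi> (k + 1))"
      by (simp only:)
    then have "\<phi> (k + 1) = \<phi> k ** (M + mat (of_int k)) + t *\<^sub>M \<phi> (k + 1)"
      by (rule sums_unique2[OF f])
    then have "\<phi> (k + 1) - t *\<^sub>M \<phi> (k + 1) = \<phi> k ** (M + mat (of_int k))"
      unfolding diff_eq_eq .
    moreover have "(1 - t) *\<^sub>M \<phi> (k + 1) = \<phi> (k + 1) - t *\<^sub>M \<phi> (k + 1)"
      by (simp add: vec_eq_iff left_diff_distrib)
    ultimately have "(1 - t) *\<^sub>M \<phi> (k + 1) = \<phi> k ** (M + mat (of_int k))"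
      by (simp only:)
    then have "(1 / (1 - t)) *\<^sub>M ((1 - t) *\<^sub>M \<phi> (k + 1)) = (1 / (1 - t)) *\<^sub>M (\<phi> k ** (M + mat (of_int k)))"
      by simp
    then show ?thesis
      using t1 by (simp add: cscale_mult_right)
  qed
  have "\<phi> k = (1 - t) powi (- k) *\<^sub>M (\<phi> 0 ** mpoch_int M k)"
  proof (rule int_recurrence_unique[where N = "\<lambda>k. (1 / (1 - t)) *\<^sub>M (M + mat (of_int k))"
        and a = \<phi> and b = "\<lambda>k. (1 - t) powi (- k) *\<^sub>M (\<phi> 0 ** mpoch_int M k)"])
    fix k
    have "(1 - t) powi (- (k + 1)) = (1 - t) powi (- k) * (1 / (1 - t))"
      using t1 by (simp add: power_int_diff)
    then show "(1 - t) powi (- (k + 1)) *\<^sub>M (\<phi> 0 ** mpoch_int M (k + 1))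
        = (1 - t) powi (- k) *\<^sub>M (\<phi> 0 ** mpoch_int M k) ** (1 / (1 - t)) *\<^sub>M (M + mat (of_int k))"
      by (simp add: mpoch_int_add_one[OF def] cscale_mult_left cscale_mult_right matrix_mul_assoc)
  qed (use rec t1 in \<open>auto intro!: invertible_cscale invertible_negative_factor[OF def]\<close>)
  moreover have "\<phi> 0 = one_minus_powr_neg t M"
    by (simp add: \<phi>_def f_def[abs_def] one_minus_powr_neg_def)
  ultimately have eq: "\<phi> k = (1 - t) powi (- k) *\<^sub>M (one_minus_powr_neg t M ** mpoch_int M k)"
    by simp
  show ?thesis
    using norm_summable_imp_has_sum[OF shifted_series_abs_summable[OF def t] f[of k, unfolded f_def]]
    unfolding eq .
qed

lemma one_minus_powr_neg_sums:
  assumes "mpoch_int_defined M" "norm t < 1"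
  shows "(\<lambda>n. (t ^ n / fact n) *\<^sub>M mpoch M n) sums one_minus_powr_neg t M"
  using has_sum_imp_sums[OF shifted_binomial_series[OF assms, of 0]] by simp

lemma one_minus_powr_neg_commute:
  fixes M :: "complex^'d^'d"
  assumes "mpoch_int_defined M" "norm t < 1" "X ** M = M ** X"
  shows "X ** one_minus_powr_neg t M = one_minus_powr_neg t M ** X"
proof -
  interpret mult: bounded_bilinear "(**) :: complex^'d^'d \<Rightarrow> complex^'d^'d \<Rightarrow> complex^'d^'d"
    by (rule bounded_bilinear_matrix_mult)
  note s = one_minus_powr_neg_sums[OF assms(1,2)]
  have "(\<lambda>n. X ** ((t ^ n / fact n) *\<^sub>M mpoch M n)) sums (X ** one_minus_powr_neg t M)"
    using mult.bounded_linear_right s by (rule bounded_linear.sums)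
  moreover have "(\<lambda>n. ((t ^ n / fact n) *\<^sub>M mpoch M n) ** X) sums (one_minus_powr_neg t M ** X)"
    using mult.bounded_linear_left s by (rule bounded_linear.sums)
  ultimately show ?thesis
    using mpoch_commute[OF assms(3)] by (simp add: cscale_mult_left cscale_mult_right sums_unique2)
qed

section \<open>The summation formulas under absolute convergence\<close>

lemma norm_div_one_minus_sq_less:
  fixes x t :: complex
  assumes "norm t < 1" "4 * norm x < (1 - norm t)\<^sup>2"
  shows "norm x < 1 / 4" "norm (x / (1 - t)\<^sup>2) < 1 / 4"
proof -
  have ge: "1 - norm t \<le> norm (1 - t)"
    using norm_triangle_ineq2[of 1 t] by simp
  have "(1 - norm t)\<^sup>2 \<le> (norm (1 - t))\<^sup>2"
    using assms ge by (intro power_mono) auto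
  then have "4 * norm x < (norm (1 - t))\<^sup>2"
    using assms by linarith
  moreover have "norm (1 - t) > 0"
    using ge assms by linarith
  ultimately show "norm (x / (1 - t)\<^sup>2) < 1 / 4"
    by (simp add: norm_divide norm_power field_simps)
  have "(1 - norm t)\<^sup>2 \<le> 1"
    using assms by (intro power_le_one) auto
  then show "norm x < 1 / 4"
    using assms by linarith
qed

text \<open>The terms of the triple series carry the product \<open>(A)\<^sub>n\<^sub>+\<^sub>k (B)\<^sub>l\<close> with \<open>k = 2m - p\<close> and \<open>l = p - m\<close>.
  Summed over \<open>m\<close> and \<open>p\<close> first, they give the series of shifted Horn functions; summed over \<open>n\<close>
  first, they give the terms of the Horn series at the rescaled arguments, because the factor
  \<open>1 - t\<close> to the power \<open>p - 2m\<close> splits between \<open>x\<^sup>m\<close> and \<open>y\<^sup>p\<close>.\<close>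

lemma hornH8_sums_first:
  fixes A B :: "complex^'d^'d"
  assumes A: "\<And>n. mpoch_int_defined (A + mat (of_nat n))" and B: "mpoch_int_defined B"
    and t: "norm t < 1" and small: "4 * norm x < (1 - norm t)\<^sup>2"
  shows "(\<lambda>n. t ^ n *\<^sub>M (((1 / fact n) *\<^sub>M mpoch A n) ** hornH8 (A + mat (of_nat n)) B x y))
    sums (one_minus_powr_neg t A ** hornH8 A B (x / (1 - t)\<^sup>2) (y * (1 - t)))"
proof -
  have A0: "mpoch_int_defined A"
    using A[of 0] by simp
  have t1: "1 - t \<noteq> 0"
    using t by auto
  note x = norm_div_one_minus_sq_less[OF t small]
  interpret mult: bounded_bilinear "(**) :: complex^'d^'d \<Rightarrow> complex^'d^'d \<Rightarrow> complex^'d^'d"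
    by (rule bounded_bilinear_matrix_mult)
  define P where "P n m p = mpoch_int A (int n + (2 * int m - int p)) ** mpoch_int B (int p - int m)" for n m p
  define c where "c m p = x ^ m * y ^ p / (fact m * fact p)" for m p
  define F where "F = (\<lambda>((m, p), n). (t ^ n / fact n * c m p) *\<^sub>M P n m p)"
  have "isCont (\<lambda>r. 4 * norm x * r ^ 3 * (1 / (1 - r * norm t)\<^sup>2)) 1"
    using t by (intro continuous_intros) auto
  then obtain r where r: "1 < r" "r * norm t < 1"
    "4 * norm x * r ^ 3 * (1 / (1 - r * norm t)\<^sup>2) < 1"
    using exists_gt_one_less_one[of "\<lambda>r. r * norm t" "\<lambda>r. 4 * norm x * r ^ 3 * (1 / (1 - r * norm t)\<^sup>2)"] t small
    by auto
  obtain C where C: "0 \<le> C" "\<And>k l. norm (mpoch_int A k ** mpoch_int B l) \<le>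
      C * r ^ (nat \<bar>k\<bar> + nat \<bar>l\<bar>) * int_fact k * int_fact l"
    using norm_mpoch_int_product_le[OF A0 B r(1)] by blast
  have "((\<lambda>n. t ^ n *\<^sub>M (((1 / fact n) *\<^sub>M mpoch A n) ** hornH8 (A + mat (of_nat n)) B x y))
      has_sum (one_minus_powr_neg t A ** hornH8 A B (x / (1 - t)\<^sup>2) (y * (1 - t)))) UNIV"
  proof (rule has_sum_exchange)
    show "(\<lambda>q. norm (F q)) summable_on UNIV \<times> UNIV"
      unfolding F_def c_def
    proof (rule triple_series_abs_summable[where r = r and C = C and u = "1 / (1 - r * norm t)\<^sup>2" and v = 2
          and k = "\<lambda>m p. 2 * int m - int p" and l = "\<lambda>m p. int p - int m"])
      fix n m p
      have "norm (P n m p) \<le> C * r ^ (nat \<bar>int n + (2 * int m - int p)\<bar> + nat \<bar>int p - int m\<bar>) *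
          int_fact (int n + (2 * int m - int p)) * int_fact (int p - int m)"
        unfolding P_def by (rule C(2))
      also have "\<dots> \<le> C * (r ^ n * (r ^ 3) ^ m * (r ^ 2) ^ p) *
          int_fact (int n + (2 * int m - int p)) * int_fact (int p - int m)"
        using C(1) by (intro mult_right_mono mult_left_mono power_shifted_index_le r) (auto simp: less_imp_le)
      finally show "norm (P n m p) \<le> C * (r ^ n * (r ^ 3) ^ m * (r ^ 2) ^ p) *
          int_fact (2 * int m - int p + int n) * int_fact (int p - int m)"
        by (simp only: add.commute)
      show "shift_weight (r * norm t) (2 * int m - int p) \<le> (1 / (1 - r * norm t)\<^sup>2) ^ m * 2 ^ p"
        using r by (intro shift_weight_le) auto
    qed (use C r in auto)
    show "((\<lambda>n. F (q, n)) has_sum one_minus_powr_neg t A ** hornH8_term A B (x / (1 - t)\<^sup>2) (y * (1 - t)) q) UNIV" for q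
    proof (cases q)
      case (Pair m p)
      let ?k = "2 * int m - int p"
      have "((\<lambda>n. c m p *\<^sub>M (((t ^ n / fact n) *\<^sub>M mpoch_int A (int n + ?k)) ** mpoch_int B (int p - int m)))
        has_sum (c m p *\<^sub>M (((1 - t) powi (- ?k) *\<^sub>M (one_minus_powr_neg t A ** mpoch_int A ?k)) ** mpoch_int B (int p - int m)))) UNIV"
        by (intro has_sum_bounded_linear[OF bounded_linear_cscale]
            has_sum_bounded_linear[OF mult.bounded_linear_left] shifted_binomial_series[OF A0 t])
      moreover have "(x / (1 - t)\<^sup>2) ^ m * (y * (1 - t)) ^ p / (fact m * fact p) = c m p * (1 - t) powi (- ?k)"
      proof -
        have "(1 - t) powi (- ?k) = (1 - t) ^ p / ((1 - t)\<^sup>2) ^ m"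
          using t1 power_int_diff[of "1 - t" "int p" "int (2 * m)"]
          by (simp only: power_int_of_nat power_mult) simp
        then show ?thesis
          by (simp add: c_def power_mult_distrib power_divide mult_ac)
      qed
      ultimately show ?thesis
        by (simp add: Pair F_def P_def hornH8_term_def cscale_mult_left cscale_mult_right matrix_mul_assoc mult.commute)
    qed
    show "((\<lambda>q. F (q, n)) has_sum t ^ n *\<^sub>M (((1 / fact n) *\<^sub>M mpoch A n) ** hornH8 (A + mat (of_nat n)) B x y)) UNIV" for n
    proof -
      have "((\<lambda>q. t ^ n *\<^sub>M (((1 / fact n) *\<^sub>M mpoch A n) ** hornH8_term (A + mat (of_nat n)) B x y q))
        has_sum (t ^ n *\<^sub>M (((1 / fact n) *\<^sub>M mpoch A n) ** hornH8 (A + mat (of_nat n)) B x y))) UNIV"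
        by (intro has_sum_bounded_linear[OF bounded_linear_cscale]
            has_sum_bounded_linear[OF mult.bounded_linear_right] has_sum_hornH8 A B x)
      moreover have "t ^ n *\<^sub>M (((1 / fact n) *\<^sub>M mpoch A n) ** hornH8_term (A + mat (of_nat n)) B x y q) = F (q, n)" for q
        by (cases q)
          (simp add: F_def P_def c_def hornH8_term_def cscale_mult_left cscale_mult_right matrix_mul_assoc
            mpoch_mpoch_int_shift[OF A0 A] mult_ac)
      ultimately show ?thesis by simp
    qed
    show "((\<lambda>q. one_minus_powr_neg t A ** hornH8_term A B (x / (1 - t)\<^sup>2) (y * (1 - t)) q)
      has_sum (one_minus_powr_neg t A ** hornH8 A B (x / (1 - t)\<^sup>2) (y * (1 - t)))) UNIV"
      by (intro has_sum_bounded_linear[OF mult.bounded_linear_right] has_sum_hornH8 A0 B x)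
  qed
  then show ?thesis
    by (rule has_sum_imp_sums)
qed

lemma norm_mult_one_minus_less:
  fixes x t :: complex
  assumes "4 * norm x * (1 + norm t) < 1"
  shows "norm x < 1 / 4" "norm (x * (1 - t)) < 1 / 4"
proof -
  have "norm (1 - t) \<le> 1 + norm t"
    using norm_triangle_ineq4[of 1 t] by simp
  then have "norm x * norm (1 - t) \<le> norm x * (1 + norm t)"
    by (intro mult_left_mono) auto
  then show "norm (x * (1 - t)) < 1 / 4"
    using assms by (simp add: norm_mult)
  have "norm x * 1 \<le> norm x * (1 + norm t)"
    by (intro mult_left_mono) auto
  then show "norm x < 1 / 4"
    using assms by simp
qed

text \<open>The same exchange with the shift in the second symbol, whose index \<open>k = p - m\<close> produces the power
  \<open>m - p\<close> of \<open>1 - t\<close>. Now \<open>(1 - t)\<close> to the power \<open>-B\<close> has to end up on the right, past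
  \<open>(B)\<^sub>k\<close>, with which it commutes.\<close>

lemma hornH8_sums_second:
  fixes A B :: "complex^'d^'d"
  assumes A: "mpoch_int_defined A" and B: "\<And>n. mpoch_int_defined (B + mat (of_nat n))"
    and t: "norm t < 1" and small: "4 * norm x * (1 + norm t) < 1"
  shows "(\<lambda>n. t ^ n *\<^sub>M (hornH8 A (B + mat (of_nat n)) x y ** ((1 / fact n) *\<^sub>M mpoch B n)))
    sums (hornH8 A B (x * (1 - t)) (y / (1 - t)) ** one_minus_powr_neg t B)"
proof -
  have B0: "mpoch_int_defined B"
    using B[of 0] by simp
  have t1: "1 - t \<noteq> 0"
    using t by auto
  note x = norm_mult_one_minus_less[OF small]
  interpret mult: bounded_bilinear "(**) :: complex^'d^'d \<Rightarrow> complex^'d^'d \<Rightarrow> complex^'d^'d"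
    by (rule bounded_bilinear_matrix_mult)
  define P where "P n m p = mpoch_int A (2 * int m - int p) ** mpoch_int B (int n + (int p - int m))" for n m p
  define c where "c m p = x ^ m * y ^ p / (fact m * fact p)" for m p
  define F where "F = (\<lambda>((m, p), n). (t ^ n / fact n * c m p) *\<^sub>M P n m p)"
  have "isCont (\<lambda>r. 4 * norm x * r ^ 3 * (1 + r * norm t)) 1"
    by (intro continuous_intros)
  then obtain r where r: "1 < r" "r * norm t < 1"
    "4 * norm x * r ^ 3 * (1 + r * norm t) < 1"
    using exists_gt_one_less_one[of "\<lambda>r. r * norm t" "\<lambda>r. 4 * norm x * r ^ 3 * (1 + r * norm t)"] t small
    by auto
  obtain C where C: "0 \<le> C" "\<And>k l. norm (mpoch_int A k ** mpoch_int B l) \<le>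
      C * r ^ (nat \<bar>k\<bar> + nat \<bar>l\<bar>) * int_fact k * int_fact l"
    using norm_mpoch_int_product_le[OF A B0 r(1)] by blast
  have comm: "one_minus_powr_neg t B ** mpoch_int B k = mpoch_int B k ** one_minus_powr_neg t B" for k
    by (rule one_minus_powr_neg_commute[OF B0 t, symmetric])
      (rule mpoch_int_commute[OF B0 refl, symmetric])
  have shift: "mpoch_int (B + mat (of_nat n)) k ** mpoch B n = mpoch_int B (int n + k)" for n k
  proof -
    have "B ** mpoch B n = mpoch B n ** B"
      by (rule mpoch_commute) simp
    then have "mpoch B n ** (B + mat (of_nat n)) = (B + mat (of_nat n)) ** mpoch B n"
      by (intro commute_add_mat) simp
    then show ?thesis
      using mpoch_mpoch_int_shift[OF B0 B, of n k] mpoch_int_commute[OF B] by metis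
  qed
  have "((\<lambda>n. t ^ n *\<^sub>M (hornH8 A (B + mat (of_nat n)) x y ** ((1 / fact n) *\<^sub>M mpoch B n)))
      has_sum (hornH8 A B (x * (1 - t)) (y / (1 - t)) ** one_minus_powr_neg t B)) UNIV"
  proof (rule has_sum_exchange)
    show "(\<lambda>q. norm (F q)) summable_on UNIV \<times> UNIV"
      unfolding F_def c_def
    proof (rule triple_series_abs_summable[where r = r and C = C and u = "1 + r * norm t" and v = "1 / (1 - r * norm t)"
          and l = "\<lambda>m p. 2 * int m - int p" and k = "\<lambda>m p. int p - int m"])
      fix n m p
      have "norm (P n m p) \<le> C * r ^ (nat \<bar>2 * int m - int p\<bar> + nat \<bar>int n + (int p - int m)\<bar>) *
          int_fact (2 * int m - int p) * int_fact (int n + (int p - int m))"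
        unfolding P_def by (rule C(2))
      also have "\<dots> \<le> C * (r ^ n * (r ^ 3) ^ m * (r ^ 2) ^ p) *
          int_fact (2 * int m - int p) * int_fact (int n + (int p - int m))"
        using C(1) by (intro mult_right_mono mult_left_mono power_shifted_index_le r) (auto simp: less_imp_le)
      finally show "norm (P n m p) \<le> C * (r ^ n * (r ^ 3) ^ m * (r ^ 2) ^ p) *
          int_fact (int p - int m + int n) * int_fact (2 * int m - int p)"
        by (simp only: add.commute mult_ac)
      show "shift_weight (r * norm t) (int p - int m) \<le> (1 + r * norm t) ^ m * (1 / (1 - r * norm t)) ^ p"
        using r by (intro shift_weight_le) auto
    qed (use C r in auto)
    show "((\<lambda>n. F (q, n)) has_sum hornH8_term A B (x * (1 - t)) (y / (1 - t)) q ** one_minus_powr_neg t B) UNIV" for q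
    proof (cases q)
      case (Pair m p)
      let ?k = "int p - int m"
      have "((\<lambda>n. c m p *\<^sub>M (mpoch_int A (2 * int m - int p) ** ((t ^ n / fact n) *\<^sub>M mpoch_int B (int n + ?k))))
        has_sum (c m p *\<^sub>M (mpoch_int A (2 * int m - int p) ** ((1 - t) powi (- ?k) *\<^sub>M (one_minus_powr_neg t B ** mpoch_int B ?k))))) UNIV"
        by (intro has_sum_bounded_linear[OF bounded_linear_cscale]
            has_sum_bounded_linear[OF mult.bounded_linear_right] shifted_binomial_series[OF B0 t])
      moreover have "(x * (1 - t)) ^ m * (y / (1 - t)) ^ p / (fact m * fact p) = c m p * (1 - t) powi (- ?k)"
      proof -
        have "(1 - t) powi (- ?k) = (1 - t) ^ m / (1 - t) ^ p"
          using t1 power_int_diff[of "1 - t" "int m" "int p"] by simp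
        then show ?thesis
          by (simp add: c_def power_mult_distrib power_divide mult_ac)
      qed
      ultimately show ?thesis
        by (simp add: Pair F_def P_def hornH8_term_def comm cscale_mult_left cscale_mult_right matrix_mul_assoc mult.commute)
    qed
    show "((\<lambda>q. F (q, n)) has_sum t ^ n *\<^sub>M (hornH8 A (B + mat (of_nat n)) x y ** ((1 / fact n) *\<^sub>M mpoch B n))) UNIV" for n
    proof -
      have "((\<lambda>q. t ^ n *\<^sub>M (hornH8_term A (B + mat (of_nat n)) x y q ** ((1 / fact n) *\<^sub>M mpoch B n)))
        has_sum (t ^ n *\<^sub>M (hornH8 A (B + mat (of_nat n)) x y ** ((1 / fact n) *\<^sub>M mpoch B n)))) UNIV"
        by (intro has_sum_bounded_linear[OF bounded_linear_cscale]
            has_sum_bounded_linear[OF mult.bounded_linear_left] has_sum_hornH8 A B x)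
      moreover have "t ^ n *\<^sub>M (hornH8_term A (B + mat (of_nat n)) x y q ** ((1 / fact n) *\<^sub>M mpoch B n)) = F (q, n)" for q
        by (cases q)
          (simp add: F_def P_def c_def hornH8_term_def cscale_mult_left cscale_mult_right shift mult_ac
            flip: matrix_mul_assoc)
      ultimately show ?thesis by simp
    qed
    show "((\<lambda>q. hornH8_term A B (x * (1 - t)) (y / (1 - t)) q ** one_minus_powr_neg t B)
      has_sum (hornH8 A B (x * (1 - t)) (y / (1 - t)) ** one_minus_powr_neg t B)) UNIV"
      by (intro has_sum_bounded_linear[OF mult.bounded_linear_left] has_sum_hornH8 A B0 x)
  qed
  then show ?thesis
    by (rule has_sum_imp_sums)
qed

section \<open>Power series at a boundary point of convergence\<close>

text \<open>Abel summation: with \<open>s\<^sub>n\<close> the error of the \<open>n\<close>-th partial sum, the power series at \<open>r\<close> differs from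
  the sum by \<open>(1 - r) \<Sum> s\<^sub>n r\<^sup>n\<close>. The finitely many large \<open>s\<^sub>n\<close> are killed by \<open>1 - r\<close>, the others contribute at
  most \<open>\<epsilon> / 2\<close>.\<close>

lemma Abel_limit_theorem:
  fixes a :: "nat \<Rightarrow> complex"
  assumes a: "a sums S"
  shows "((\<lambda>r. \<Sum>n. a n * of_real r ^ n) \<longlongrightarrow> S) (at_left (1 :: real))"
proof (rule tendstoI)
  fix \<epsilon> :: real
  assume \<epsilon>: "0 < \<epsilon>"
  define s where "s n = (\<Sum>i\<le>n. a i) - S" for n
  have "s \<longlonglongrightarrow> 0"
    using a unfolding s_def sums_def_le by (simp add: LIM_zero)
  then obtain N where N: "\<And>n. N \<le> n \<Longrightarrow> norm (s n) < \<epsilon> / 2"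
    using LIMSEQ_D[of s 0 "\<epsilon> / 2"] \<epsilon> by auto
  define K where "K = (\<Sum>n<N. norm (s n))"
  have K: "0 \<le> K"
    by (simp add: K_def sum_nonneg)
  have bound: "norm ((\<Sum>n. a n * of_real r ^ n) - S) \<le> (1 - r) * K + \<epsilon> / 2" if r: "0 < r" "r < 1" for r
  proof -
    define z where "z = complex_of_real r"
    define b where "b n = s n * z ^ n" for n
    define d where "d n = (if n < N then norm (s n) else 0) + \<epsilon> / 2 * r ^ n" for n
    have "(\<lambda>n. if n < N then norm (s n) else 0) sums K"
      unfolding K_def using sums_If_finite_set[of "{..<N}" "\<lambda>n. norm (s n)"] by simp
    moreover have "(\<lambda>n. \<epsilon> / 2 * r ^ n) sums (\<epsilon> / 2 * (1 / (1 - r)))"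
      using r by (intro sums_mult geometric_sums) auto
    ultimately have d: "d sums (K + \<epsilon> / 2 * (1 / (1 - r)))"
      unfolding d_def by (rule sums_add)
    have bd: "norm (b n) \<le> d n" for n
    proof (cases "n < N")
      case True
      have "norm (s n) * r ^ n \<le> norm (s n) * 1"
        using r by (intro mult_left_mono power_le_one) auto
      then show ?thesis
        using True r \<epsilon> by (simp add: b_def d_def z_def norm_mult norm_power add_increasing2)
    next
      case False
      then show ?thesis
        using N[of n] r by (simp add: b_def d_def z_def norm_mult norm_power mult_right_mono less_imp_le)
    qed
    have b: "b sums suminf b"
      using bd sums_summable[OF d] by (intro summable_sums summable_comparison_test[of b d]) auto
    have "norm (suminf b) \<le> K + \<epsilon> / 2 * (1 / (1 - r))"
      using norm_suminf_le[OF bd sums_summable[OF d]] sums_unique[OF d] by simp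
    then have "(1 - r) * norm (suminf b) \<le> (1 - r) * (K + \<epsilon> / 2 * (1 / (1 - r)))"
      using r by (intro mult_left_mono) auto
    also have "\<dots> = (1 - r) * K + \<epsilon> / 2"
      using r by (simp add: field_simps)
    finally have le: "(1 - r) * norm (suminf b) \<le> (1 - r) * K + \<epsilon> / 2" .
    \<comment> \<open>Summation by parts: \<open>a (Suc n)\<close> is the difference of consecutive errors.\<close>
    have "(\<lambda>n. b (Suc n)) sums (suminf b - b 0)"
      using b by (simp add: sums_Suc_iff)
    then have "(\<lambda>n. b (Suc n) - z * b n) sums (suminf b - b 0 - z * suminf b)"
      by (intro sums_diff sums_mult b)
    moreover have "b (Suc n) - z * b n = a (Suc n) * z ^ Suc n" for n
      by (simp add: b_def s_def algebra_simps)
    ultimately have "(\<lambda>n. a (Suc n) * z ^ Suc n) sums (suminf b - b 0 - z * suminf b)"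
      by simp
    then have "(\<lambda>n. a n * z ^ n) sums (suminf b - b 0 - z * suminf b + a 0 * z ^ 0)"
      by (rule sums_Suc)
    then have "(\<Sum>n. a n * z ^ n) = suminf b - b 0 - z * suminf b + a 0 * z ^ 0"
      by (rule sums_unique[symmetric])
    then have "(\<Sum>n. a n * z ^ n) - S = (1 - z) * suminf b"
      by (simp add: b_def s_def algebra_simps)
    then have "norm ((\<Sum>n. a n * z ^ n) - S) = norm (1 - z) * norm (suminf b)"
      by (simp add: norm_mult)
    moreover have "norm (1 - z) = 1 - r"
    proof -
      have "1 - z = of_real (1 - r)" by (simp add: z_def)
      then show ?thesis using r by (simp only: norm_of_real)
    qed
    ultimately show ?thesis
      using le by (simp add: z_def)
  qed
  have "((\<lambda>r. (1 - r) * K + \<epsilon> / 2) \<longlongrightarrow> (1 - 1) * K + \<epsilon> / 2) (at_left (1 :: real))"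
    by (intro tendsto_intros)
  then have "eventually (\<lambda>r. (1 - r) * K + \<epsilon> / 2 < \<epsilon>) (at_left (1 :: real))"
    by (rule order_tendstoD(2)) (use \<epsilon> in simp)
  moreover have "eventually (\<lambda>r. r \<in> {0<..<1}) (at_left (1 :: real))"
    by (rule eventually_at_left_real) simp
  ultimately show "eventually (\<lambda>r. dist (\<Sum>n. a n * of_real r ^ n) S < \<epsilon>) (at_left (1 :: real))"
  proof eventually_elim
    case (elim r)
    then show ?case
      using bound[of r] by (simp add: dist_norm)
  qed
qed

text \<open>Convergence at \<open>t\<close> makes the power series holomorphic on the disc of radius \<open>\<bar>t\<bar>\<close>, so it agrees with \<open>G\<close>
  on the connected part of the disc where \<open>G\<close> is holomorphic. The point \<open>t\<close> itself lies on the boundary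
  circle; it is reached radially, by Abel's theorem on one side and continuity of \<open>G\<close> on the other.\<close>

lemma power_series_sums_by_continuation:
  fixes c :: "nat \<Rightarrow> complex"
  assumes summ: "summable (\<lambda>n. c n * t ^ n)"
    and U: "open U" "connected (U \<inter> ball 0 (norm t))" "0 \<in> U" "t \<in> U"
    and G: "G holomorphic_on U"
    and e: "0 < e" "\<And>s. norm s < e \<Longrightarrow> (\<lambda>n. c n * s ^ n) sums G s"
  shows "(\<lambda>n. c n * t ^ n) sums G t"
proof (cases "t = 0")
  case True
  then show ?thesis using e(1) e(2)[of t] by simp
next
  case False
  define P where "P s = (\<Sum>n. c n * s ^ n)" for s
  let ?B = "ball (0 :: complex) (norm t)"
  have P: "(\<lambda>n. c n * (s - 0) ^ n) sums P s" if "s \<in> ?B" for s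
    using powser_inside[OF summ, of s] that by (simp add: P_def summable_sums)
  have holP: "P holomorphic_on ?B"
    using P by (rule power_series_holomorphic)
  have eq: "P s = G s" if "s \<in> U \<inter> ?B" for s
  proof (rule analytic_continuation_open[of "U \<inter> ?B \<inter> ball 0 e" "U \<inter> ?B" P G])
    have "0 \<in> U \<inter> ?B \<inter> ball 0 e"
      using U e False by simp
    then show "U \<inter> ?B \<inter> ball 0 e \<noteq> {}" by blast
    show "P s = G s" if "s \<in> U \<inter> ?B \<inter> ball 0 e" for s
      using e(2)[of s] that by (auto simp: P_def dest: sums_unique)
    show "P holomorphic_on U \<inter> ?B" "G holomorphic_on U \<inter> ?B"
      using holP G by (auto elim: holomorphic_on_subset)
  qed (use U that in auto)
  have abel: "((\<lambda>r. \<Sum>n. c n * t ^ n * of_real r ^ n) \<longlongrightarrow> (\<Sum>n. c n * t ^ n)) (at_left (1 :: real))"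
    using summ by (intro Abel_limit_theorem summable_sums)
  have "((\<lambda>r. of_real r * t) \<longlongrightarrow> of_real 1 * t) (at_left (1 :: real))"
    by (intro tendsto_intros)
  then have lim: "((\<lambda>r. of_real r * t) \<longlongrightarrow> t) (at_left (1 :: real))"
    by simp
  have "isCont G t"
    using holomorphic_on_imp_continuous_on[OF G] U(4) continuous_on_eq_continuous_at[OF U(1)] by blast
  then have limG: "((\<lambda>r. G (of_real r * t)) \<longlongrightarrow> G t) (at_left (1 :: real))"
    using lim by (rule isCont_tendsto_compose)
  have "eventually (\<lambda>r. of_real r * t \<in> U) (at_left (1 :: real))"
    using lim U(1,4) by (rule topological_tendstoD)
  moreover have "eventually (\<lambda>r. r \<in> {0<..<1}) (at_left (1 :: real))"
    by (rule eventually_at_left_real) simp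
  ultimately have "eventually (\<lambda>r. (\<Sum>n. c n * t ^ n * of_real r ^ n) = G (of_real r * t)) (at_left (1 :: real))"
  proof eventually_elim
    case (elim r)
    then have "of_real r * t \<in> U \<inter> ?B"
      using False by (simp add: norm_mult)
    then have "P (of_real r * t) = G (of_real r * t)"
      by (rule eq)
    then show ?case
      by (simp add: P_def power_mult_distrib mult_ac)
  qed
  then have "((\<lambda>r. G (of_real r * t)) \<longlongrightarrow> (\<Sum>n. c n * t ^ n)) (at_left (1 :: real))"
    by (rule Lim_transform_eventually[OF abel])
  then have "(\<Sum>n. c n * t ^ n) = G t"
    using limG by (rule tendsto_unique[OF trivial_limit_at_left_real])
  then show ?thesis
    using summ by (simp add: summable_sums_iff)
qed

lemma bounded_linear_matrix_entry: "bounded_linear (\<lambda>M :: complex^'d^'d. M $ i $ j)"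
  by (intro bounded_linear_compose[OF bounded_linear_vec_nth bounded_linear_vec_nth])

lemma norm_matrix_entry_le:
  fixes M :: "complex^'d^'d"
  shows "norm (M $ i $ j) \<le> norm M"
  using Finite_Cartesian_Product.norm_nth_le[of "M $ i" j] Finite_Cartesian_Product.norm_nth_le[of M i]
  by linarith

lemma matrix_sumsI:
  fixes f :: "nat \<Rightarrow> complex^'d^'d"
  assumes "\<And>i j. (\<lambda>n. f n $ i $ j) sums (S $ i $ j)"
  shows "f sums S"
  using assms unfolding sums_def by (intro vec_tendstoI) simp

lemma matrix_power_series_sums_by_continuation:
  fixes c :: "nat \<Rightarrow> complex^'d^'d"
  assumes summ: "summable (\<lambda>n. t ^ n *\<^sub>M c n)"
    and U: "open U" "connected (U \<inter> ball 0 (norm t))" "0 \<in> U" "t \<in> U"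
    and G: "\<And>i j. (\<lambda>s. G s $ i $ j) holomorphic_on U"
    and e: "0 < e" "\<And>s. norm s < e \<Longrightarrow> (\<lambda>n. s ^ n *\<^sub>M c n) sums G s"
  shows "(\<lambda>n. t ^ n *\<^sub>M c n) sums G t"
proof (rule matrix_sumsI)
  fix i j
  have "(\<lambda>n. c n $ i $ j * t ^ n) sums (G t $ i $ j)"
  proof (rule power_series_sums_by_continuation[OF _ U G e(1)])
    show "summable (\<lambda>n. c n $ i $ j * t ^ n)"
      using bounded_linear.summable[OF bounded_linear_matrix_entry summ, of i j]
      by (simp add: mult.commute)
    show "(\<lambda>n. c n $ i $ j * s ^ n) sums (G s $ i $ j)" if "norm s < e" for s
      using bounded_linear.sums[OF bounded_linear_matrix_entry e(2)[OF that], of i j]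
      by (simp add: mult.commute)
  qed
  then show "(\<lambda>n. (t ^ n *\<^sub>M c n) $ i $ j) sums (G t $ i $ j)"
    by (simp add: mult.commute)
qed

section \<open>Holomorphy of the closed forms\<close>

lemma one_minus_powr_neg_holomorphic:
  assumes "mpoch_int_defined M"
  shows "(\<lambda>s. one_minus_powr_neg s M $ i $ j) holomorphic_on ball 0 1"
proof (rule power_series_holomorphic)
  fix s :: complex
  assume "s \<in> ball 0 1"
  then have "(\<lambda>n. ((s ^ n / fact n) *\<^sub>M mpoch M n) $ i $ j) sums (one_minus_powr_neg s M $ i $ j)"
    using assms by (intro bounded_linear.sums[OF bounded_linear_matrix_entry] one_minus_powr_neg_sums) auto
  then show "(\<lambda>n. mpoch M n $ i $ j / fact n * (s - 0) ^ n) sums (one_minus_powr_neg s M $ i $ j)"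
    by (simp add: mult_ac)
qed

text \<open>Near each point of \<open>U\<close> the arguments stay in a compact polydisc where one majorant applies, so the
  entries are locally uniform limits of polynomials in \<open>f\<close> and \<open>g\<close>.\<close>

lemma hornH8_holomorphic:
  fixes A B :: "complex^'d^'d"
  assumes AB: "mpoch_int_defined A" "mpoch_int_defined B" and U: "open U"
    and f: "f holomorphic_on U" and g: "g holomorphic_on U"
    and less: "\<And>s. s \<in> U \<Longrightarrow> norm (f s) < 1 / 4"
  shows "(\<lambda>s. hornH8 A B (f s) (g s) $ i $ j) holomorphic_on U"
proof -
  let ?h = "\<lambda>q s. hornH8_term A B (f s) (g s) q $ i $ j"
  have "\<exists>e>0. (\<lambda>s. hornH8 A B (f s) (g s) $ i $ j) holomorphic_on ball z e" if z: "z \<in> U" for z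
  proof -
    obtain e where e: "0 < e" "cball z e \<subseteq> U"
      using U z open_contains_cball by blast
    have holo: "?h q holomorphic_on U" for q
      using f g by (cases q) (auto simp: hornH8_term_def intro!: holomorphic_intros)
    have cont: "continuous_on (cball z e) f" "continuous_on (cball z e) g"
      using continuous_on_subset[OF holomorphic_on_imp_continuous_on e(2)] f g by simp_all
    obtain z1 where z1: "z1 \<in> cball z e" "\<And>s. s \<in> cball z e \<Longrightarrow> norm (f s) \<le> norm (f z1)"
      using continuous_attains_sup[OF compact_cball _ continuous_on_norm[OF cont(1)]] e(1) by auto
    obtain z2 where z2: "z2 \<in> cball z e" "\<And>s. s \<in> cball z e \<Longrightarrow> norm (g s) \<le> norm (g z2)"
      using continuous_attains_sup[OF compact_cball _ continuous_on_norm[OF cont(2)]] e(1) by auto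
    have "norm (f z1) < 1 / 4"
      using less e z1 by blast
    then obtain b where b: "b summable_on UNIV"
      "\<And>x y q. norm x \<le> norm (f z1) \<Longrightarrow> norm y \<le> norm (g z2) \<Longrightarrow> norm (hornH8_term A B x y q) \<le> b q"
      using hornH8_term_majorant[OF AB norm_ge_zero _ norm_ge_zero, of "f z1" "g z2"] by blast
    have lim: "uniform_limit (cball z e) (\<lambda>F s. \<Sum>q\<in>F. ?h q s) (\<lambda>s. hornH8 A B (f s) (g s) $ i $ j)
      (finite_subsets_at_top UNIV)"
    proof (rule Weierstrass_m_test_general'[OF _ _ b(1)])
      fix q s
      assume "s \<in> cball z e"
      then have "norm (hornH8_term A B (f s) (g s) q) \<le> b q"
        by (intro b z1 z2)
      then show "norm (?h q s) \<le> b q"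
        by (rule order_trans[OF norm_matrix_entry_le])
    next
      fix s
      assume "s \<in> cball z e"
      then show "((\<lambda>q. ?h q s) has_sum (hornH8 A B (f s) (g s) $ i $ j)) UNIV"
        using e by (intro has_sum_bounded_linear[OF bounded_linear_matrix_entry] has_sum_hornH8 AB less) auto
    qed
    have ev: "eventually (\<lambda>F. continuous_on (cball z e) (\<lambda>s. \<Sum>q\<in>F. ?h q s) \<and>
        (\<lambda>s. \<Sum>q\<in>F. ?h q s) holomorphic_on ball z e) (finite_subsets_at_top UNIV)"
    proof (intro always_eventually allI conjI)
      fix F
      have "(\<lambda>s. \<Sum>q\<in>F. ?h q s) holomorphic_on U"
        by (intro holomorphic_on_sum holo)
      then show "continuous_on (cball z e) (\<lambda>s. \<Sum>q\<in>F. ?h q s)" "(\<lambda>s. \<Sum>q\<in>F. ?h q s) holomorphic_on ball z e"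
        using continuous_on_subset[OF holomorphic_on_imp_continuous_on e(2)]
          holomorphic_on_subset[OF _ subset_trans[OF ball_subset_cball e(2)]] by simp_all
    qed
    have "(\<lambda>s. hornH8 A B (f s) (g s) $ i $ j) holomorphic_on ball z e"
      using ev lim finite_subsets_at_top_neq_bot by (rule holomorphic_uniform_limit)
    then show ?thesis
      using e(1) by blast
  qed
  then have "(\<lambda>s. hornH8 A B (f s) (g s) $ i $ j) analytic_on U"
    by (simp add: analytic_on_def)
  then show ?thesis
    by (rule analytic_imp_holomorphic)
qed

lemma holomorphic_on_matrix_mult_entry:
  fixes P Q :: "complex \<Rightarrow> complex^'d^'d"
  assumes "\<And>i j. (\<lambda>s. P s $ i $ j) holomorphic_on U" "\<And>i j. (\<lambda>s. Q s $ i $ j) holomorphic_on U"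
  shows "(\<lambda>s. (P s ** Q s) $ i $ j) holomorphic_on U"
  using assms by (auto simp: matrix_matrix_mult_def intro!: holomorphic_intros)

section \<open>Connectedness of the continuation domains\<close>

lemma convex_scaled_ball: "convex {w :: complex. a * norm (w - z) < b}" if "0 \<le> a"
proof (cases "a = 0")
  case False
  then have "{w :: complex. a * norm (w - z) < b} = ball z (b / a)"
    using that by (auto simp: dist_norm norm_minus_commute field_simps)
  then show ?thesis by simp
qed simp

text \<open>Points whose distances to \<open>1\<close> and \<open>0\<close> have ratio below \<open>R\<close> form a disc of Apollonius, here with
  centre \<open>k = 1 / (1 - R\<^sup>2)\<close> and radius \<open>R k\<close>.\<close>

lemma convex_apollonius_disc:
  assumes R: "0 \<le> R" "R < 1"
  shows "convex {w :: complex. norm (w - 1) < R * norm w}"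
proof -
  define k where "k = 1 / (1 - R\<^sup>2)"
  have R2: "0 < 1 - R\<^sup>2"
    using R by (simp add: abs_square_less_1 power2_less_1_iff)
  have k: "k > 0" "k * (1 - R\<^sup>2) = 1"
    using R2 by (auto simp: k_def)
  have "norm (w - 1) < R * norm w \<longleftrightarrow> norm (w - of_real k) < R * k" for w :: complex
  proof -
    have "norm (w - 1) < R * norm w \<longleftrightarrow> (norm (w - 1))\<^sup>2 < (R * norm w)\<^sup>2"
      using R power_mono_iff[of "R * norm w" "norm (w - 1)" 2] by (simp add: not_le[symmetric] del: power_mono_iff)
    also have "\<dots> \<longleftrightarrow> k * ((norm (w - 1))\<^sup>2 - (R * norm w)\<^sup>2) < 0"
      using k by (auto simp: mult_less_0_iff)
    also have "k * ((norm (w - 1))\<^sup>2 - (R * norm w)\<^sup>2) = (norm (w - of_real k))\<^sup>2 - (R * k)\<^sup>2"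
    proof -
      have "k * ((norm (w - 1))\<^sup>2 - (R * norm w)\<^sup>2)
          = (k * (1 - R\<^sup>2)) * ((Re w)\<^sup>2 + (Im w)\<^sup>2) - 2 * k * Re w + k"
        by (simp add: cmod_power2 power_mult_distrib power2_diff algebra_simps)
      also have "\<dots> = (Re w)\<^sup>2 + (Im w)\<^sup>2 - 2 * k * Re w + k * (k * (1 - R\<^sup>2))"
        by (simp add: k)
      also have "\<dots> = (norm (w - of_real k))\<^sup>2 - (R * k)\<^sup>2"
        unfolding cmod_power2 by (simp add: power2_eq_square algebra_simps)
      finally show ?thesis .
    qed
    also have "\<dots> < 0 \<longleftrightarrow> norm (w - of_real k) < R * k"
      using R k power_mono_iff[of "R * k" "norm (w - of_real k)" 2]
      by (simp add: not_le[symmetric] del: power_mono_iff)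
    finally show ?thesis .
  qed
  then have "{w :: complex. norm (w - 1) < R * norm w} = {w. 1 * norm (w - of_real k) < R * k}"
    by simp
  then show ?thesis
    using convex_scaled_ball[of 1] by simp
qed

text \<open>The set need not be starlike about \<open>0\<close>. The substitution \<open>w = 1 / (1 - s)\<close> turns the disc around \<open>0\<close>
  into a disc of Apollonius and the exterior of the disc around \<open>1\<close> into a disc around \<open>0\<close> (the plane if
  \<open>\<rho> = 0\<close>), so the set is a continuous image of a convex one.\<close>

lemma connected_disc_minus_disc:
  assumes R: "0 \<le> R" "R < 1" and \<rho>: "0 \<le> \<rho>"
  shows "connected {s :: complex. norm s < R \<and> \<rho> < norm (1 - s)}"
proof -
  define D where "D = {w :: complex. norm (w - 1) < R * norm w} \<inter> {w. \<rho> * norm (w - 0) < 1}"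
  have "convex D"
    unfolding D_def using R \<rho> by (intro convex_Int convex_apollonius_disc convex_scaled_ball)
  moreover have nz: "w \<noteq> 0" if "w \<in> D" for w
    using that by (auto simp: D_def)
  ultimately have "connected ((\<lambda>w. 1 - 1 / w) ` D)"
    by (intro connected_continuous_image convex_connected continuous_intros) auto
  moreover have "(\<lambda>w. 1 - 1 / w) ` D = {s. norm s < R \<and> \<rho> < norm (1 - s)}"
  proof (intro equalityI subsetI)
    fix s
    assume "s \<in> (\<lambda>w. 1 - 1 / w) ` D"
    then obtain w where w: "w \<in> D" "s = 1 - 1 / w" by blast
    have "s = (w - 1) / w"
      using nz[OF w(1)] w(2) by (simp add: field_simps)
    then have "norm s = norm (w - 1) / norm w"
      by (simp add: norm_divide)
    moreover have "norm (1 - s) = 1 / norm w"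
      using w(2) by (simp add: norm_divide)
    ultimately show "s \<in> {s. norm s < R \<and> \<rho> < norm (1 - s)}"
      using w(1) nz[OF w(1)] by (simp add: D_def divide_less_eq less_divide_eq)
  next
    fix s :: complex
    assume s: "s \<in> {s. norm s < R \<and> \<rho> < norm (1 - s)}"
    then have ne: "1 - s \<noteq> 0"
      using \<rho> by auto
    define w where "w = 1 / (1 - s)"
    have "w - 1 = s / (1 - s)"
      using ne by (simp add: w_def field_simps)
    then have "w \<in> D"
      using s ne by (simp add: D_def w_def norm_divide field_simps)
    moreover have "s = 1 - 1 / w"
      by (simp add: w_def)
    ultimately show "s \<in> (\<lambda>w. 1 - 1 / w) ` D" by blast
  qed
  ultimately show ?thesis by simp
qed

section \<open>The summation formulas under mere summability\<close>

text \<open>Both sides are functions of \<open>t\<close> that agree for small \<open>t\<close>. With \<open>\<rho> = 2 \<surd>\<bar>x\<bar>\<close>, the closed form is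
  holomorphic where \<open>\<bar>s\<bar> < 1\<close> and \<open>\<rho> < \<bar>1 - s\<bar>\<close>, and absolute convergence holds for \<open>\<bar>s\<bar> < 1 - \<rho>\<close>. The segment from
  \<open>0\<close> to \<open>t\<close> may leave this domain, whence the continuation along a merely connected set.\<close>

lemma hornH8_sums_first_of_summable:
  fixes A B :: "complex^'d^'d"
  assumes A: "\<And>n. mpoch_int_defined (A + mat (of_nat n))" and B: "mpoch_int_defined B"
    and t: "norm t < 1" and x: "norm x < 1 / 4" and xt: "norm (x / (1 - t)\<^sup>2) < 1 / 4"
    and summ: "summable (\<lambda>n. t ^ n *\<^sub>M
      (((1 / fact n) *\<^sub>M mpoch A n) ** hornH8 (A + mat (of_nat n)) B x y))"
  shows "(\<lambda>n. t ^ n *\<^sub>M (((1 / fact n) *\<^sub>M mpoch A n) ** hornH8 (A + mat (of_nat n)) B x y))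
    sums (one_minus_powr_neg t A ** hornH8 A B (x / (1 - t)\<^sup>2) (y * (1 - t)))"
proof -
  define \<rho> where "\<rho> = sqrt (4 * norm x)"
  have \<rho>: "0 \<le> \<rho>" "\<rho>\<^sup>2 = 4 * norm x" "\<rho> < 1"
    using x by (auto simp: \<rho>_def)
  define U where "U = {s :: complex. norm s < 1 \<and> \<rho> < norm (1 - s)}"
  have A0: "mpoch_int_defined A"
    using A[of 0] by simp
  have ne: "1 - s \<noteq> 0" if "s \<in> U" for s
    using that \<rho>(1) by (auto simp: U_def)
  have less_iff: "norm (x / (1 - s)\<^sup>2) < 1 / 4 \<longleftrightarrow> \<rho> < norm (1 - s)" if "1 - s \<noteq> 0" for s
  proof -
    have "norm (x / (1 - s)\<^sup>2) < 1 / 4 \<longleftrightarrow> \<rho>\<^sup>2 < (norm (1 - s))\<^sup>2"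
      using that by (simp add: \<rho>(2) norm_divide norm_power divide_less_eq mult.commute)
    also have "\<dots> \<longleftrightarrow> \<rho> < norm (1 - s)"
      using \<rho>(1) power_mono_iff[of "norm (1 - s)" \<rho> 2] by (simp add: not_le[symmetric] del: power_mono_iff)
    finally show ?thesis .
  qed
  define G where "G s = one_minus_powr_neg s A ** hornH8 A B (x / (1 - s)\<^sup>2) (y * (1 - s))" for s
  have "(\<lambda>n. t ^ n *\<^sub>M (((1 / fact n) *\<^sub>M mpoch A n) ** hornH8 (A + mat (of_nat n)) B x y)) sums G t"
  proof (rule matrix_power_series_sums_by_continuation[OF summ])
    show U: "open U"
      unfolding U_def by (intro open_Collect_conj open_Collect_less continuous_intros)
    have "U \<inter> ball 0 (norm t) = {s. norm s < norm t \<and> \<rho> < norm (1 - s)}"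
      using t by (auto simp: U_def)
    then show "connected (U \<inter> ball 0 (norm t))"
      using connected_disc_minus_disc[of "norm t" \<rho>] t \<rho> by simp
    show "0 \<in> U"
      using \<rho> by (simp add: U_def)
    have "1 - t \<noteq> 0"
      using t by auto
    then show "t \<in> U"
      using less_iff[of t] xt t by (simp add: U_def)
    have "(\<lambda>s. one_minus_powr_neg s A $ i $ j) holomorphic_on U" for i j
      by (rule holomorphic_on_subset[OF one_minus_powr_neg_holomorphic[OF A0]]) (auto simp: U_def)
    moreover have "(\<lambda>s. hornH8 A B (x / (1 - s)\<^sup>2) (y * (1 - s)) $ i $ j) holomorphic_on U" for i j
    proof (rule hornH8_holomorphic[OF A0 B U])
      show "norm (x / (1 - s)\<^sup>2) < 1 / 4" if "s \<in> U" for s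
        using that less_iff[OF ne[OF that]] by (simp add: U_def)
    qed (use ne in \<open>auto intro!: holomorphic_intros\<close>)
    ultimately show "(\<lambda>s. G s $ i $ j) holomorphic_on U" for i j
      unfolding G_def by (rule holomorphic_on_matrix_mult_entry)
    show "0 < 1 - \<rho>"
      using \<rho> by simp
    show "(\<lambda>n. s ^ n *\<^sub>M (((1 / fact n) *\<^sub>M mpoch A n) ** hornH8 (A + mat (of_nat n)) B x y)) sums G s"
      if s: "norm s < 1 - \<rho>" for s
      unfolding G_def
    proof (rule hornH8_sums_first[OF A B])
      show "norm s < 1"
        using s \<rho> by linarith
      have "\<rho>\<^sup>2 < (1 - norm s)\<^sup>2"
        using s \<rho> by (intro power_strict_mono) auto
      then show "4 * norm x < (1 - norm s)\<^sup>2"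
        by (simp add: \<rho>)
    qed
  qed
  then show ?thesis
    by (simp add: G_def)
qed

text \<open>As for the first formula; this time the domain of the closed form is convex, since the condition on
  the first argument is \<open>\<bar>x\<bar> \<bar>1 - s\<bar> < 1/4\<close>.\<close>

lemma hornH8_sums_second_of_summable:
  fixes A B :: "complex^'d^'d"
  assumes A: "mpoch_int_defined A" and B: "\<And>n. mpoch_int_defined (B + mat (of_nat n))"
    and t: "norm t < 1" and x: "norm x < 1 / 4" and xt: "norm (x * (1 - t)) < 1 / 4"
    and summ: "summable (\<lambda>n. t ^ n *\<^sub>M
      (hornH8 A (B + mat (of_nat n)) x y ** ((1 / fact n) *\<^sub>M mpoch B n)))"
  shows "(\<lambda>n. t ^ n *\<^sub>M (hornH8 A (B + mat (of_nat n)) x y ** ((1 / fact n) *\<^sub>M mpoch B n)))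
    sums (hornH8 A B (x * (1 - t)) (y / (1 - t)) ** one_minus_powr_neg t B)"
proof -
  define U where "U = {s :: complex. norm s < 1 \<and> norm (x * (1 - s)) < 1 / 4}"
  have B0: "mpoch_int_defined B"
    using B[of 0] by simp
  define G where "G s = hornH8 A B (x * (1 - s)) (y / (1 - s)) ** one_minus_powr_neg s B" for s
  have "(\<lambda>n. t ^ n *\<^sub>M (hornH8 A (B + mat (of_nat n)) x y ** ((1 / fact n) *\<^sub>M mpoch B n))) sums G t"
  proof (rule matrix_power_series_sums_by_continuation[OF summ])
    show U: "open U"
      unfolding U_def by (intro open_Collect_conj open_Collect_less continuous_intros)
    have "U \<inter> ball 0 (norm t) = {s. norm x * norm (s - 1) < 1 / 4} \<inter> ball 0 (norm t)"
      using t by (auto simp: U_def norm_mult norm_minus_commute)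
    then show "connected (U \<inter> ball 0 (norm t))"
      by (simp only:) (intro convex_connected convex_Int convex_scaled_ball convex_ball norm_ge_zero)
    show "0 \<in> U" "t \<in> U"
      using x xt t by (simp_all add: U_def)
    have "(\<lambda>s. one_minus_powr_neg s B $ i $ j) holomorphic_on U" for i j
      by (rule holomorphic_on_subset[OF one_minus_powr_neg_holomorphic[OF B0]]) (auto simp: U_def)
    moreover have "(\<lambda>s. hornH8 A B (x * (1 - s)) (y / (1 - s)) $ i $ j) holomorphic_on U" for i j
      by (rule hornH8_holomorphic[OF A B0 U]) (auto simp: U_def intro!: holomorphic_intros)
    ultimately show "(\<lambda>s. G s $ i $ j) holomorphic_on U" for i j
      unfolding G_def by (rule_tac holomorphic_on_matrix_mult_entry)
    show "0 < 1 - 4 * norm x"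
      using x by simp
    show "(\<lambda>n. s ^ n *\<^sub>M (hornH8 A (B + mat (of_nat n)) x y ** ((1 / fact n) *\<^sub>M mpoch B n))) sums G s"
      if s: "norm s < 1 - 4 * norm x" for s
      unfolding G_def
    proof (rule hornH8_sums_second[OF A B])
      show "norm s < 1"
        using s norm_ge_zero[of x] by linarith
      have "4 * norm x * norm s \<le> 1 * norm s"
        using x by (intro mult_right_mono) auto
      then show "4 * norm x * (1 + norm s) < 1"
        using s by (simp add: distrib_left)
    qed
  qed
  then show ?thesis
    by (simp add: G_def)
qed

theorem theorem5p20:
  fixes A B :: "complex^'d^'d" and x y t :: complex
  assumes "norm t < 1" and "norm x < 1/4"
  shows
    "((\<forall>n. mpoch_int_defined (A + mat (of_nat n))) \<and> mpoch_int_defined B \<and>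
        norm (x / (1 - t)\<^sup>2) < 1/4 \<longrightarrow>
       (let f = (\<lambda>n. t ^ n *\<^sub>M
                   (((1 / fact n) *\<^sub>M mpoch A n) ** hornH8 (A + mat (of_nat n)) B x y))
        in 4 * norm x < (1 - norm t)\<^sup>2 \<or> summable f \<longrightarrow>
           f sums (one_minus_powr_neg t A ** hornH8 A B (x / (1 - t)\<^sup>2) (y * (1 - t)))))
     \<and>
     (mpoch_int_defined A \<and> (\<forall>n. mpoch_int_defined (B + mat (of_nat n))) \<and>
        norm (x * (1 - t)) < 1/4 \<longrightarrow>
       (let f = (\<lambda>n. t ^ n *\<^sub>M
                   (hornH8 A (B + mat (of_nat n)) x y ** ((1 / fact n) *\<^sub>M mpoch B n)))
        in 4 * norm x * (1 + norm t) < 1 \<or> summable f \<longrightarrow>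
           f sums (hornH8 A B (x * (1 - t)) (y / (1 - t)) ** one_minus_powr_neg t B)))"
  unfolding Let_def
proof (intro conjI impI; elim conjE disjE)
  assume A: "\<forall>n. mpoch_int_defined (A + mat (of_nat n))" and B: "mpoch_int_defined B"
  then show "(\<lambda>n. t ^ n *\<^sub>M (((1 / fact n) *\<^sub>M mpoch A n) ** hornH8 (A + mat (of_nat n)) B x y))
      sums (one_minus_powr_neg t A ** hornH8 A B (x / (1 - t)\<^sup>2) (y * (1 - t)))"
    if "4 * norm x < (1 - norm t)\<^sup>2"
    using that assms(1) by (intro hornH8_sums_first) auto
  show "(\<lambda>n. t ^ n *\<^sub>M (((1 / fact n) *\<^sub>M mpoch A n) ** hornH8 (A + mat (of_nat n)) B x y))
      sums (one_minus_powr_neg t A ** hornH8 A B (x / (1 - t)\<^sup>2) (y * (1 - t)))"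
    if xt: "norm (x / (1 - t)\<^sup>2) < 1 / 4"
      and summ: "summable (\<lambda>n. t ^ n *\<^sub>M (((1 / fact n) *\<^sub>M mpoch A n) ** hornH8 (A + mat (of_nat n)) B x y))"
  proof (rule hornH8_sums_first_of_summable)
  qed (use A B assms xt summ in auto)
next
  assume A: "mpoch_int_defined A" and B: "\<forall>n. mpoch_int_defined (B + mat (of_nat n))"
  then show "(\<lambda>n. t ^ n *\<^sub>M (hornH8 A (B + mat (of_nat n)) x y ** ((1 / fact n) *\<^sub>M mpoch B n)))
      sums (hornH8 A B (x * (1 - t)) (y / (1 - t)) ** one_minus_powr_neg t B)"
    if "4 * norm x * (1 + norm t) < 1"
    using that assms(1) by (intro hornH8_sums_second) auto
  show "(\<lambda>n. t ^ n *\<^sub>M (hornH8 A (B + mat (of_nat n)) x y ** ((1 / fact n) *\<^sub>M mpoch B n)))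
      sums (hornH8 A B (x * (1 - t)) (y / (1 - t)) ** one_minus_powr_neg t B)"
    if xt: "norm (x * (1 - t)) < 1 / 4"
      and summ: "summable (\<lambda>n. t ^ n *\<^sub>M (hornH8 A (B + mat (of_nat n)) x y ** ((1 / fact n) *\<^sub>M mpoch B n)))"
  proof (rule hornH8_sums_second_of_summable)
  qed (use A B assms xt summ in auto)
qed

end
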